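(* Let $V=\bigoplus_{t\in\mathbb{F}_{13}}V_t$ be the $78$-dimensional real vector space, and let $H=\langle a,b,d,e\rangle$ be the group of real-linear automorphisms of $V$, defined in the context. Let $[\cdot,\cdot]$ be the unique $H$-invariant anti-symmetric real-bilinear product on $V$ with $$[(1,0,0)_0,(1,0,0)_1]=(\overline{\omega},1,1)_3-(1,\overline{\omega},\overline{\omega})_9,$$ $$[(1,0,0)_1,(1,0,0)_9]=-(1,\omega,\omega)_0+(\overline{\omega},\omega,\omega)_3.$$ Then $[\cdot,\cdot]$ satisfies the Jacobi identity: $[[x,y],z]+[[y,z],x]+[[z,x],y]=0$ for all $x,y,z\in V$.
   Context: Let $\omega=e^{2\pi i/3}$, $\overline{\omega}=\omega^2$. For each $t\in\mathbb{F}_{13}=\{0,1,\dots,12\}$ let $V_t$ be a copy of $\mathbb{C}^3$, regarded as a $6$-dimensional real vector space; for $v\in\mathbb{C}^3$ write $v_t$ for the corresponding vector of $V_t$. Let $V=\bigoplus_{t}V_t$ (real dimension $78$). Complex scalars are only notation: all maps and products are real-(bi)linear. Group elements act on the right (products $gh$ mean first $g$, then $h$). Define real-linear automorphisms of $V$ as follows (subscripts mod $13$). $a$: $v_t\mapsto v_{t+1}$. $b$: $(x,y,z)_t\mapsto(\omega x,\overline{\omega}y,\overline{\omega}z)_{3t}$. $d$: $v_t\mapsto\delta_tv_t$ where $(\delta_0,\dots,\delta_{12})=(1,\omega,1,\omega,\omega,\omega,\overline{\omega},\overline{\omega},1,\omega,\overline{\omega},\omega,1)$. $e$: $(x,y,z)_0\mapsto(x,y,z)_0$;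 $(x,y,z)_t\mapsto(z,x,y)_t$ for $t=1,11$; $(x,y,z)_2\mapsto(\overline{\omega}y,z,\omega x)_2$; $(x,y,z)_t\mapsto(\overline{\omega}z,\omega x,y)_t$ for $t=3,7$; $(x,y,z)_t\mapsto(x,\omega y,\overline{\omega}z)_t$ for $t=4,10,12$; $(x,y,z)_5\mapsto(y,z,x)_5$; $(x,y,z)_6\mapsto(\omega y,z,\overline{\omega}x)_6$; $(x,y,z)_t\mapsto(\omega z,\overline{\omega}x,y)_t$ for $t=8,9$. Put $H=\langle a,b,d,e\rangle$. A bilinear product on $V$ is $H$-invariant if $[u^g,v^g]=[u,v]^g$ for all $u,v\in V$, $g\in H$. It is known that there is exactly one $H$-invariant anti-symmetric real-bilinear product with the two values given in the claim. *)

theory Defs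
  imports "HOL-Analysis.Analysis" "HOL-Algebra.Generated_Groups"
begin

text \<open>
  The index set is the numeral type \<open>13\<close>, i.e. the integers mod 13, so subscript arithmetic is
  ring arithmetic in that type. An element of \<open>complex^3^13\<close> is a family \<open>(v\<^sub>t)\<close> of vectors in
  \<open>complex^3\<close>; the type is used only as a real vector space (\<open>linear\<close> and \<open>bilinear\<close> are
  the real notions). The vector written \<open>v\<^sub>t\<close>, for \<open>v\<close> in \<open>complex^3\<close>, is \<open>axis t v\<close>.
\<close>

type_synonym V = "complex^3^13"

definition \<omega> :: complex where
  "\<omega> = exp (2 * of_real pi * \<i> / 3)"

definition \<omega>' :: complex where
  "\<omega>' = \<omega>\<^sup>2"

text \<open>The additive extension of \<open>v\<^sub>t \<mapsto> (f t v)\<^bsub>\<sigma> t\<^esub>\<close>; see \<open>block_map_axis\<close> below.\<close>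

definition block_map :: "(13 \<Rightarrow> 13) \<Rightarrow> (13 \<Rightarrow> complex^3 \<Rightarrow> complex^3) \<Rightarrow> V \<Rightarrow> V" where
  "block_map \<sigma> f v = (\<Sum>t\<in>UNIV. axis (\<sigma> t) (f t (v $ t)))"

definition gen_a :: "V \<Rightarrow> V" where
  "gen_a = block_map (\<lambda>t. t + 1) (\<lambda>t v. v)"

definition gen_b :: "V \<Rightarrow> V" where
  "gen_b = block_map (\<lambda>t. 3 * t) (\<lambda>t v. vector [\<omega> * v$1, \<omega>' * v$2, \<omega>' * v$3])"

definition \<delta> :: "13 \<Rightarrow> complex" where
  "\<delta> t = (if t \<in> {1, 3, 4, 5, 9, 11} then \<omega> else if t \<in> {6, 7, 10} then \<omega>' else 1)"

definition gen_d :: "V \<Rightarrow> V" where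
  "gen_d = block_map (\<lambda>t. t) (\<lambda>t v. \<delta> t *s v)"

definition e_block :: "13 \<Rightarrow> complex^3 \<Rightarrow> complex^3" where
  "e_block t v = (let x = v$1; y = v$2; z = v$3 in
     if t = 0 then vector [x, y, z]
     else if t \<in> {1, 11} then vector [z, x, y]
     else if t = 2 then vector [\<omega>' * y, z, \<omega> * x]
     else if t \<in> {3, 7} then vector [\<omega>' * z, \<omega> * x, y]
     else if t \<in> {4, 10, 12} then vector [x, \<omega> * y, \<omega>' * z]
     else if t = 5 then vector [y, z, x]
     else if t = 6 then vector [\<omega> * y, z, \<omega>' * x]
     else \<comment> \<open>\<open>t \<in> {8, 9}\<close>\<close> vector [\<omega> * z, \<omega>' * x, y])"

definition gen_e :: "V \<Rightarrow> V" where
  "gen_e = block_map (\<lambda>t. t) e_block"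

text \<open>Elements act on the right: the product \<open>g h\<close> means first \<open>g\<close>, then \<open>h\<close>.\<close>

definition GLV :: "(V \<Rightarrow> V) monoid" where
  "GLV = \<lparr>carrier = {g. linear g \<and> bij g}, mult = (\<lambda>g h. h \<circ> g), one = id\<rparr>"

definition H :: "(V \<Rightarrow> V) set" where
  "H = generate GLV {gen_a, gen_b, gen_d, gen_e}"

definition H_invariant :: "(V \<Rightarrow> V \<Rightarrow> V) \<Rightarrow> bool" where
  "H_invariant p \<longleftrightarrow> (\<forall>g\<in>H. \<forall>u v. p (g u) (g v) = g (p u v))"

definition antisymmetric :: "(V \<Rightarrow> V \<Rightarrow> V) \<Rightarrow> bool" where
  "antisymmetric p \<longleftrightarrow> (\<forall>u v. p u v = - p v u)"

text \<open>
  Well-formedness: \<open>GLV\<close> is a group containing the four generators, so that \<open>H\<close> is the subgroup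
  they generate.
\<close>

lemma block_map_axis:
  assumes "\<And>s. f s 0 = 0"
  shows "block_map \<sigma> f (axis t v) = axis (\<sigma> t) (f t v)"
proof -
  have ax0: "axis s (0::complex^3) = 0" for s :: 13
    by (simp add: axis_def vec_eq_iff)
  have "axis (\<sigma> s) (f s (axis t v $ s)) = (if s = t then axis (\<sigma> t) (f t v) else 0)" for s
    by (simp add: assms axis_nth ax0) (simp add: axis_def assms ax0)
  then show ?thesis
    by (simp add: block_map_def)
qed

lemma block_map_nth:
  assumes "inj \<sigma>"
  shows "block_map \<sigma> f v $ \<sigma> t = f t (v $ t)"
proof -
  have "axis (\<sigma> s) (f s (v $ s)) $ \<sigma> t = (if s = t then f t (v $ t) else 0)" for s
    using assms by (auto simp: axis_def inj_eq)
  then show ?thesis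
    by (simp add: block_map_def sum_component)
qed

lemma block_map_in_GLV:
  assumes \<sigma>: "inj \<sigma>" and lin: "\<And>t. linear (f t)" and inj: "\<And>t. inj (f t)"
  shows "block_map \<sigma> f \<in> carrier GLV"
proof -
  have surj: "surj \<sigma>"
    using \<sigma> by (simp add: finite_UNIV_inj_surj)
  have eqI: "u = v" if "\<And>t. u $ \<sigma> t = v $ \<sigma> t" for u v :: V
    using that surj by (metis vec_eq_iff surjD)
  have linear: "linear (block_map \<sigma> f)"
    by (rule linearI; rule eqI)
      (simp_all add: block_map_nth[OF \<sigma>] linear_add[OF lin] linear_cmul[OF lin])
  have "inj (block_map \<sigma> f)"
  proof (rule injI)
    fix u v assume "block_map \<sigma> f u = block_map \<sigma> f v"
    then have "f t (u $ t) = f t (v $ t)" for t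
      by (metis block_map_nth[OF \<sigma>])
    then show "u = v"
      using inj by (simp add: vec_eq_iff[of u v] inj_eq)
  qed
  then have "bij (block_map \<sigma> f)"
    using linear by (simp add: bij_def linear_injective_imp_surjective)
  then show ?thesis
    using linear by (simp add: GLV_def)
qed

lemma \<omega>_nonzero [simp]: "\<omega> \<noteq> 0" "\<omega>' \<noteq> 0"
  by (simp_all add: \<omega>_def \<omega>'_def)

lemma \<omega>'_eq_cnj: "\<omega>' = cnj \<omega>"
proof -
  have "\<omega> ^ 3 = exp (2 * of_real pi * \<i>)"
    unfolding \<omega>_def by (simp add: mult_ac flip: exp_of_nat_mult)
  then have "\<omega> ^ 3 = 1"
    by (simp only: exp_two_pi_i)
  moreover have "\<omega> * cnj \<omega> = 1"
    by (simp add: \<omega>_def exp_cnj flip: exp_add)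
  ultimately have "\<omega> * \<omega>' = \<omega> * cnj \<omega>"
    by (simp add: \<omega>'_def power2_eq_square power3_eq_cube mult.assoc)
  then show ?thesis by simp
qed

lemma generators_in_GLV: "{gen_a, gen_b, gen_d, gen_e} \<subseteq> carrier GLV"
proof -
  have "inj (\<lambda>t::13. 3 * t)"
  proof (rule injI)
    fix s t :: 13 assume "3 * s = 3 * t"
    then have "9 * (3 * s) = 9 * (3 * t)" by simp
    moreover have "9 * (3 * r) = r" for r :: 13
    proof -
      have "9 * (3 * r) = (27 :: 13) * r" by simp
      also have "(27 :: 13) = 1" by simp
      finally show ?thesis by simp
    qed
    ultimately show "s = t" by (simp only:)
  qed
  then have "gen_b \<in> carrier GLV"
    unfolding gen_b_def
    by (rule block_map_in_GLV; intro linearI injI)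
      (simp_all add: vec_eq_iff forall_3 algebra_simps)
  moreover have "gen_a \<in> carrier GLV"
    unfolding gen_a_def by (rule block_map_in_GLV) (auto intro!: linearI injI)
  moreover have "\<delta> t \<noteq> 0" for t
    by (simp add: \<delta>_def)
  then have "gen_d \<in> carrier GLV"
    unfolding gen_d_def
    by (intro block_map_in_GLV linearI injI)
      (simp_all add: vec_eq_iff algebra_simps)
  moreover have "linear (e_block t)" "inj (e_block t)" for t
    unfolding e_block_def Let_def
    by (intro linearI injI; simp add: vec_eq_iff forall_3 algebra_simps split: if_splits)+
  then have "gen_e \<in> carrier GLV"
    unfolding gen_e_def by (intro block_map_in_GLV) simp_all
  ultimately show ?thesis by simp
qed

lemma group_GLV: "group GLV"
proof (rule groupI)
  fix g assume "g \<in> carrier GLV"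
  then have g: "linear g" "bij g" by (simp_all add: GLV_def)
  have "linear (Hilbert_Choice.inv g)"
    using g by (simp add: inj_linear_imp_inv_linear bij_is_inj)
  with g show "\<exists>h\<in>carrier GLV. h \<otimes>\<^bsub>GLV\<^esub> g = \<one>\<^bsub>GLV\<^esub>"
    by (intro bexI[of _ "Hilbert_Choice.inv g"])
      (auto simp: GLV_def bij_imp_bij_inv bij_is_surj simp flip: surj_iff)
qed (auto simp: GLV_def linear_compose bij_comp linear_id o_assoc module_hom_id)

lemma H_subgroup: "subgroup H GLV"
  unfolding H_def using group_GLV generators_in_GLV by (rule group.generate_is_subgroup)

end

theory Submission
  imports Defs
begin

text \<open>
  The Lie algebra in question is the compact real form of \<open>E\<^sub>6\<close>, and the Jacobi identity is proved
  by finding its 27-dimensional representation: a linear map \<open>rep\<close> from the 78-dimensional space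
  into the operators on a 27-dimensional space which is injective (\<open>rep_eq_0_imp\<close>) and turns the
  given product into the commutator (\<open>rep_hom_all\<close>). Commutators satisfy the Jacobi identity, and
  injectivity carries it back.

  The 27-dimensional space consists of the complex functions on the affine space of dimension 3
  over the field with three elements. The conjugates of \<open>d\<close> act as a scalar on every block, and
  this grades everything: block \<open>t\<close> acts by a weighted shift along its weight \<open>weight t\<close> minus the
  adjoint of that shift. What has to be found are the weight functions of the shifts. They are
  given by \<open>base_coeff\<close> for block 0 and carried to the other blocks by the linear map of order 13
  that permutes the weights as \<open>a\<close> permutes the blocks.

  The group \<open>H\<close> acts on functions by monomial matrices: \<open>a\<close> and \<open>b\<close> through linear maps of the affine
  space, \<open>d\<close> through characters and \<open>e\<close> through the translation by \<open>weight 0\<close>, combined with phases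
  that are polynomial functions of the point. The representation intertwines the two actions
  (\<open>coeff_a\<close>, \<open>coeff_b\<close>, \<open>coeff_d\<close>, \<open>coeff_e\<close> and \<open>rep_block_map\<close>). Hence the set of pairs on which \<open>rep\<close>
  respects the product is closed under \<open>H\<close>, and it is enough to examine one pair of vectors from
  each of the block pairs \<open>(0, 1)\<close> and \<open>(1, 9)\<close>, for which the product is given. There the claim is
  a comparison of coefficients at 27 points (\<open>coeff_commutator_0_1\<close>, \<open>coeff_commutator_1_9\<close>). The
  \<open>H\<close>-orbits of these pairs span everything that involves two different blocks.

  It remains to see that a block is abelian, on both sides. For operators this is visible from
  the weight functions (\<open>rep_commute_0\<close>). For the product it follows from invariance (\<open>br_0_0\<close>): on
  block 0 the stabiliser induces, among other things, all diagonal matrices of cube roots of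
  unity, and no nonzero antisymmetric product is invariant under these.
\<close>

section \<open>Arithmetic mod 3 and mod 13, and cube roots of unity\<close>

lemma UNIV_13: "(UNIV :: 13 set) = {0, 1, 2, 3, 4, 5, 6, 7, 8, 9, 10, 11, 12}"
proof -
  have "card {0 :: 13, 1, 2, 3, 4, 5, 6, 7, 8, 9, 10, 11, 12} = 13" by simp
  then show ?thesis by (intro card_subset_eq[symmetric]) auto
qed

lemma forall_13: "(\<forall>t :: 13. P t) \<longleftrightarrow> P 0 \<and> P 1 \<and> P 2 \<and> P 3 \<and> P 4 \<and> P 5 \<and> P 6 \<and> P 7 \<and> P 8
    \<and> P 9 \<and> P 10 \<and> P 11 \<and> P 12"
proof -
  have "(\<forall>t :: 13. P t) \<longleftrightarrow> (\<forall>t\<in>{0, 1, 2, 3, 4, 5, 6, 7, 8, 9, 10, 11, 12}. P t)"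
    unfolding UNIV_13[symmetric] by simp
  then show ?thesis by simp
qed

lemma of_nat_surj_13: "\<exists>n. t = (of_nat n :: 13)"
proof -
  have "\<forall>t :: 13. \<exists>n. t = of_nat n"
    unfolding forall_13 by (intro conjI) (metis of_nat_0, metis of_nat_1, (metis of_nat_numeral)+)
  then show ?thesis ..
qed

text \<open>
  The integers mod 13 are generated by 1, so a property that is preserved by \<open>t \<mapsto> t + 1\<close> spreads
  from 0 to all indices. This is how invariance under \<open>gen_a\<close> gets used.
\<close>
lemma induct_13 [case_names zero step]:
  assumes "P 0" and "\<And>t. P t \<Longrightarrow> P (t + 1)"
  shows "P (t :: 13)"
proof -
  have "P (of_nat n)" for n :: nat
    using assms(1) by (induction n) (simp_all add: assms(2)[of "of_nat _", simplified add.commute])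
  with of_nat_surj_13[of t] show ?thesis by auto
qed

lemma forall_mod_3: "(\<forall>x :: 3. P x) \<longleftrightarrow> P 0 \<and> P 1 \<and> P 2"
proof -
  have "(3 :: 3) = 0" by simp
  then show ?thesis unfolding forall_3 by metis
qed

text \<open>
  Addition and multiplication tables of the field with three elements. Together with
  \<open>forall_mod_3\<close> they decide any polynomial identity over it by running through all values.
\<close>
lemma arith_mod_3:
  "(0 :: 3) + x = x" "x + (0 :: 3) = x" "(1 :: 3) + 1 = 2" "(1 :: 3) + 2 = 0" "(2 :: 3) + 1 = 0"
      "(2 :: 3) + 2 = 1"
  "(0 :: 3) * x = 0" "x * (0 :: 3) = 0" "(1 :: 3) * x = x" "x * (1 :: 3) = x" "(2 :: 3) * 2 = 1"
  "x - (0 :: 3) = x" "(0 :: 3) - 1 = 2" "(0 :: 3) - 2 = 1" "(1 :: 3) - 1 = 0" "(1 :: 3) - 2 = 2"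
  "(2 :: 3) - 1 = 1" "(2 :: 3) - 2 = 0" "- (0 :: 3) = 0" "- (1 :: 3) = 2" "- (2 :: 3) = 1"
  "(0 :: 3) \<noteq> 1" "(0 :: 3) \<noteq> 2" "(1 :: 3) \<noteq> 0" "(1 :: 3) \<noteq> 2" "(2 :: 3) \<noteq> 0" "(2 :: 3) \<noteq> 1"
  by simp_all

lemma omega_sq: "\<omega> * \<omega> = \<omega>'" "\<omega> * \<omega>' = 1" "\<omega>' * \<omega> = 1" "\<omega>' * \<omega>' = \<omega>"
  and omega'_eq: "\<omega>' = - 1 - \<omega>" and omega_neq_1: "\<omega> \<noteq> 1"
proof -
  have 1: "cnj \<omega> * \<omega> = 1"
    by (simp add: \<omega>_def exp_cnj flip: exp_add)
  show *: "\<omega> * \<omega> = \<omega>'" by (simp add: \<omega>'_def power2_eq_square)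
  show **: "\<omega> * \<omega>' = 1" "\<omega>' * \<omega> = 1" using 1 by (simp_all add: \<omega>'_eq_cnj mult.commute)
  show "\<omega>' * \<omega>' = \<omega>"
    by (metis * ** mult.assoc mult.right_neutral)
  have \<omega>: "\<omega> = cis (2 * pi / 3)"
    by (simp add: \<omega>_def cis_conv_exp mult.commute)
  have "Re \<omega> = - 1 / 2" unfolding \<omega> using cos_120 by (simp add: field_simps)
  then show "\<omega>' = - 1 - \<omega>" unfolding \<omega>'_eq_cnj by (simp add: complex_eq_iff)
  show "\<omega> \<noteq> 1" using \<open>Re \<omega> = _\<close> by auto
qed

definition omega_pow :: "3 \<Rightarrow> complex" where
  "omega_pow x = (if x = 0 then 1 else if x = 1 then \<omega> else \<omega>')"

definition sign3 :: "3 \<Rightarrow> complex" where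
  "sign3 x = (if x = 0 then 0 else if x = 1 then 1 else - 1)"

lemma omega_pow_add: "omega_pow (x + y) = omega_pow x * omega_pow y"
proof -
  have "\<forall>x y. omega_pow (x + y) = omega_pow x * omega_pow y"
    unfolding forall_mod_3 omega_pow_def by (simp add: omega_sq)
  then show ?thesis by blast
qed

lemma cnj_omega_pow: "cnj (omega_pow x) = omega_pow (- x)"
proof -
  have "\<forall>x. cnj (omega_pow x) = omega_pow (- x)"
    unfolding forall_mod_3 omega_pow_def by (simp add: \<omega>'_eq_cnj)
  then show ?thesis by blast
qed

lemma omega_pow_0 [simp]: "omega_pow 0 = 1"
  by (simp_all add: omega_pow_def)

lemma cnj_omega_pow_mult [simp]: "omega_pow x * cnj (omega_pow x) = 1"
    "cnj (omega_pow x) * omega_pow x = 1"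
  by (simp_all add: cnj_omega_pow flip: omega_pow_add)

section \<open>Weights and the Singer cycle\<close>

text \<open>
  The basis of the 27-dimensional representation is indexed by the points of the affine space
  over the field with three elements.
\<close>
type_synonym F = "3 \<times> 3 \<times> 3"

definition d_exp :: "13 \<Rightarrow> 3" where
  "d_exp t = (if t \<in> {1, 3, 4, 5, 9, 11} then 1 else if t \<in> {6, 7, 10} then 2 else 0)"

lemma delta_eq: "\<delta> t = omega_pow (d_exp t)"
  by (simp add: \<delta>_def d_exp_def omega_pow_def)

lemma d_exp_recurrence: "d_exp (t + 3) = d_exp (t + 1) + d_exp t"
proof -
  have "\<forall>t. d_exp (t + 3) = d_exp (t + 1) + d_exp t"
    unfolding forall_13 d_exp_def by simp
  then show ?thesis by blast
qed

text \<open>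
  The conjugates of \<open>gen_d\<close> under powers of \<open>gen_a\<close> generate an elementary abelian group of order 27
  that acts on each block by cube roots of unity. The vector \<open>weight t\<close> lists the exponents with
  which \<open>d\<close>, \<open>a d a\<^sup>-\<^sup>1\<close> and \<open>a\<^sup>2 d a\<^sup>-\<^sup>2\<close> act on block \<open>t\<close>; the 13 weights are representatives of the
  13 pairs of opposite nonzero vectors.
\<close>
definition weight :: "13 \<Rightarrow> F" where
  "weight t = (d_exp t, d_exp (t + 1), d_exp (t + 2))"

text \<open>
  The recurrence of \<open>d_exp\<close> makes \<open>weight t \<mapsto> weight (t + 1)\<close> extend to a linear map of order 13, a
  Singer cycle. The formula for its \<open>t\<close>-th power comes from writing \<open>(x, y, z)\<close> as \<open>x\<close> times \<open>weight 1\<close>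
  plus \<open>y\<close> times \<open>weight 0\<close> plus \<open>z - x\<close> times \<open>weight (- 1)\<close>.
\<close>
definition singer :: "13 \<Rightarrow> F \<Rightarrow> F" where
  "singer t = (\<lambda>(x, y, z).
     let comb = (\<lambda>r. x * d_exp (r + 1) + y * d_exp r + (z - x) * d_exp (r - 1))
     in (comb t, comb (t + 1), comb (t + 2)))"

lemma singer_0 [simp]: "singer 0 \<psi> = \<psi>"
  by (cases \<psi>) (simp add: singer_def d_exp_def)

lemma singer_1: "singer 1 (x, y, z) = (y, z, x + y)"
  by (simp add: singer_def d_exp_def)

lemma singer_add_one: "singer (t + 1) \<psi> = singer 1 (singer t \<psi>)"
proof (cases \<psi>)
  case (fields x y z)
  define comb where "comb r = x * d_exp (r + 1) + y * d_exp r + (z - x) * d_exp (r - 1)" for r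
  have singer: "singer r \<psi> = (comb r, comb (r + 1), comb (r + 2))" for r
    by (simp add: fields singer_def comb_def Let_def)
  have "comb (t + 3) = comb t + comb (t + 1)"
    using d_exp_recurrence[of t] d_exp_recurrence[of "t + 1"] d_exp_recurrence[of "t - 1"]
    by (simp add: comb_def algebra_simps)
  then show ?thesis
    by (simp add: singer singer_1 add.assoc)
qed

lemma singer_plus: "singer t (\<psi> + \<phi>) = singer t \<psi> + singer t \<phi>"
  by (cases \<psi>; cases \<phi>) (simp add: singer_def Let_def algebra_simps)

lemma singer_add: "singer (s + t) \<psi> = singer s (singer t \<psi>)"
proof (induction s rule: induct_13)
  case (step s)
  have "singer (s + 1 + t) \<psi> = singer (s + t + 1) \<psi>" by (simp add: ac_simps)
  then show ?case using step by (simp only: singer_add_one)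
qed simp

lemma singer_weight: "singer s (weight t) = weight (s + t)"
proof -
  have *: "singer r (weight 0) = weight r" for r
    by (simp add: weight_def singer_def d_exp_def[of 0] d_exp_def[of 1] d_exp_def[of 2])
  show ?thesis
    by (metis * singer_add)
qed

text \<open>
  The linear map that takes \<open>weight t\<close> to \<open>weight (3 * t)\<close>: on the field with 27 elements, in which
  the Singer cycle is a multiplication, it is the Frobenius map.
\<close>
definition perm_b :: "F \<Rightarrow> F" where
  "perm_b = (\<lambda>(x, y, z). (2 * x + 2 * z, y + z, x))"

lemma weight_table:
  "weight 0 = (0, 1, 0)" "weight 1 = (1, 0, 1)" "weight 2 = (0, 1, 1)" "weight 3 = (1, 1, 1)"
  "weight 4 = (1, 1, 2)" "weight 5 = (1, 2, 2)" "weight 6 = (2, 2, 0)" "weight 7 = (2, 0, 1)"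
  "weight 8 = (0, 1, 2)" "weight 9 = (1, 2, 1)" "weight 10 = (2, 1, 0)" "weight 11 = (1, 0, 0)"
  "weight 12 = (0, 0, 1)"
  by (simp_all add: weight_def d_exp_def)

lemma singer_eq_weight:
  assumes "weight t = (p, q, r)"
  shows "singer t (x, y, z) = (x * q + y * p + (z - x) * (r - p), x * r + y * q + (z - x) * p,
    x * (p + q) + y * r + (z - x) * q)"
proof -
  have s: "d_exp t = p" "d_exp (t + 1) = q" "d_exp (t + 2) = r"
    using assms by (simp_all add: weight_def)
  have "d_exp (t - 1) = r - p" "d_exp (t + 3) = p + q"
    using d_exp_recurrence[of "t - 1"] d_exp_recurrence[of t] s by (simp_all add: algebra_simps)
  with s show ?thesis
    by (simp add: singer_def Let_def add.assoc add.commute[of 1 t])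
qed

lemma neg_mod_13: "- (0 :: 13) = 0" "- (1 :: 13) = 12" "- (2 :: 13) = 11" "- (3 :: 13) = 10"
  "- (4 :: 13) = 9" "- (5 :: 13) = 8" "- (6 :: 13) = 7" "- (7 :: 13) = 6" "- (8 :: 13) = 5"
  "- (9 :: 13) = 4" "- (10 :: 13) = 3" "- (11 :: 13) = 2" "- (12 :: 13) = 1"
  by simp_all

text \<open>
  The pairs that occur are listed so that statements about \<open>weight t\<close> and \<open>weight (- t)\<close> can be
  checked for the 13 indices separately.
\<close>
lemma weight_cases:
  "(weight t, weight (- t)) \<in> {((0, 1, 0), (0, 1, 0)), ((1, 0, 1), (0, 0, 1)),
      ((0, 1, 1), (1, 0, 0)), ((1, 1, 1), (2, 1, 0)), ((1, 1, 2), (1, 2, 1)),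
      ((1, 2, 2), (0, 1, 2)), ((2, 2, 0), (2, 0, 1)), ((2, 0, 1), (2, 2, 0)),
      ((0, 1, 2), (1, 2, 2)), ((1, 2, 1), (1, 1, 2)), ((2, 1, 0), (1, 1, 1)),
      ((1, 0, 0), (0, 1, 1)), ((0, 0, 1), (1, 0, 1))}"
proof -
  have "\<forall>t. (weight t, weight (- t)) \<in> {((0, 1, 0), (0, 1, 0)), ((1, 0, 1), (0, 0, 1)),
      ((0, 1, 1), (1, 0, 0)), ((1, 1, 1), (2, 1, 0)), ((1, 1, 2), (1, 2, 1)),
      ((1, 2, 2), (0, 1, 2)), ((2, 2, 0), (2, 0, 1)), ((2, 0, 1), (2, 2, 0)),
      ((0, 1, 2), (1, 2, 2)), ((1, 2, 1), (1, 1, 2)), ((2, 1, 0), (1, 1, 1)),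
      ((1, 0, 0), (0, 1, 1)), ((0, 0, 1), (1, 0, 1))}"
    unfolding forall_13 by (simp only: neg_mod_13 weight_table insert_iff simp_thms)
  then show ?thesis ..
qed

section \<open>Phases and coefficient functions\<close>

text \<open>
  The generators \<open>e\<close> and \<open>b\<close> will act on functions by an affine substitution combined with
  multiplication by \<open>\<omega>\<close> to the power \<open>phase_e\<close> and \<open>phase_b\<close>. The phases solve \<open>phase_e_identity\<close> and
  \<open>phase_b_identity\<close>, which are linear equations over the field with three elements in the unknown
  values. Rescaling the 27 basis vectors changes the solution; the scaling is chosen so that
  \<open>phase_e\<close> and \<open>base_phase\<close> become quadratic.
\<close>
definition phase_e :: "F \<Rightarrow> 3" where
  "phase_e = (\<lambda>(x, y, z). 2 * z + 2 * z * z + y * z + x * z + 2 * x * x)"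

definition phase_b :: "F \<Rightarrow> 3" where
  "phase_b = (\<lambda>(x, y, z). - x - y - z + y * y * z + x * z * z - x * y * y + x * x * y)"

definition base_phase :: "3 \<Rightarrow> F \<Rightarrow> 3" where
  "base_phase i = (\<lambda>(x, y, z). y * z - z - z * z - (i - 1) * x)"

lemma phase_e_identity:
  assumes "weight (- t) = (a, b, c)"
  shows "a * (i + 2 * (c - a) - 1) + base_phase (i + (c - a)) (\<phi> + (a, b, c)) + phase_e (singer t \<phi>)
    = phase_e (singer t \<phi> + weight t) + base_phase i \<phi>"
proof (cases \<phi>)
  case (fields x y z)
  obtain p q r where weight: "weight t = (p, q, r)" by (cases "weight t")
  have "\<forall>x y z i. a * (i + 2 * (c - a) - 1) + base_phase (i + (c - a)) ((x, y, z) + (a, b, c))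
      + phase_e (singer t (x, y, z))
    = phase_e (singer t (x, y, z) + weight t) + base_phase i (x, y, z)"
    using weight_cases[of t] unfolding singer_eq_weight[OF weight] assms weight insert_iff empty_iff
        prod.inject
    by (elim disjE conjE FalseE) (simp only: forall_mod_3 phase_e_def base_phase_def add_Pair
        prod.case arith_mod_3 simp_thms)+
  then show ?thesis unfolding fields by blast
qed

lemma perm_b_plus: "perm_b (\<psi> + \<phi>) = perm_b \<psi> + perm_b \<phi>"
  by (cases \<psi>; cases \<phi>) (simp add: perm_b_def algebra_simps)

lemma perm_b_weight: "perm_b (weight t) = weight (3 * t)"
proof -
  have "\<forall>t. perm_b (weight t) = weight (3 * t)"
    unfolding forall_13 by (simp add: weight_def d_exp_def perm_b_def)
  then show ?thesis by blast
qed

lemma perm_b_singer: "perm_b (singer t \<psi>) = singer (3 * t) (perm_b \<psi>)"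
proof (induction t rule: induct_13)
  case (step t)
  have *: "perm_b (singer 1 \<phi>) = singer 3 (perm_b \<phi>)" for \<phi>
  proof (cases \<phi>)
    case (fields x y z)
    have "\<forall>x y z. perm_b (singer 1 (x, y, z)) = singer 3 (perm_b (x, y, z))"
      unfolding singer_1 singer_eq_weight[OF weight_table(4)]
      by (simp only: forall_mod_3 perm_b_def singer_eq_weight[OF weight_table(4)] prod.case
          prod.inject arith_mod_3 simp_thms)
    then show ?thesis unfolding fields by blast
  qed
  have "singer (3 * (t + 1)) (perm_b \<psi>) = singer 3 (singer (3 * t) (perm_b \<psi>))"
    by (simp add: algebra_simps flip: singer_add)
  then show ?case
    using step by (simp only: singer_add_one *)
qed simp

definition b_exp :: "3 \<Rightarrow> 3" where
  "b_exp i = (if i = 1 then 1 else 2)"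

text \<open>
  The left side exceeds the right by a polynomial that need not vanish on the plane \<open>x - z + i =
  1\<close>. That plane is excluded since the coefficient of index \<open>i\<close> is zero there.
\<close>
lemma phase_b_identity:
  assumes "fst \<phi> - snd (snd \<phi>) + i - 1 \<noteq> 0"
  shows "b_exp i + base_phase i (perm_b \<phi>) + phase_b (singer t \<phi>)
      = phase_b (singer t \<phi> + weight t) + base_phase i \<phi>"
proof (cases \<phi>)
  case (fields x y z)
  obtain p q r where weight: "weight t = (p, q, r)" by (cases "weight t")
  have "\<forall>x y z i. x - z + i - 1 = 0 \<or>
     b_exp i + base_phase i (perm_b (x, y, z)) + phase_b (singer t (x, y, z))
      = phase_b (singer t (x, y, z) + weight t) + base_phase i (x, y, z)"
    using weight_cases[of t] unfolding singer_eq_weight[OF weight] weight insert_iff empty_iff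
        prod.inject
    by (elim disjE conjE FalseE) (simp only: forall_mod_3 phase_b_def base_phase_def perm_b_def
        b_exp_def add_Pair prod.case arith_mod_3 simp_thms if_True if_False)+
  then show ?thesis using assms unfolding fields by auto
qed

text \<open>
  The coefficient functions of block 0. Translations by vectors of the plane \<open>x = z\<close>, which is
  spanned by \<open>weight 0\<close> and \<open>weight 1\<close>, correspond to the conjugates of \<open>e\<close> that are diagonal on block
  0, and they only multiply each of the three functions by phases. A translation across that
  plane corresponds to a conjugate that permutes the coordinates cyclically; this accounts for
  the dependence on \<open>x - z + i\<close>. Each function vanishes on one of three parallel planes and has
  opposite signs on the other two. The factor \<open>\<omega> - \<omega>'\<close> adjusts the scale: the commutator is
  quadratic in the coefficients and the bracket is linear in them, so a solution cannot be
  rescaled.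
\<close>
definition base_coeff :: "3 \<Rightarrow> F \<Rightarrow> complex" where
  "base_coeff i \<psi> = (\<omega> - \<omega>') * sign3 (fst \<psi> - snd (snd \<psi>) + i - 1) * omega_pow (base_phase i \<psi>)"

definition coeff :: "13 \<Rightarrow> complex^3 \<Rightarrow> F \<Rightarrow> complex" where
  "coeff t u \<psi> = (\<Sum>i\<in>UNIV. u $ i * base_coeff i (singer (- t) \<psi>))"

lemma coeff_add: "coeff t (u + v) \<psi> = coeff t u \<psi> + coeff t v \<psi>"
  by (simp add: coeff_def algebra_simps sum.distrib)

lemma coeff_scale: "coeff t (k *s u) \<psi> = k * coeff t u \<psi>"
  by (simp add: coeff_def algebra_simps sum_distrib_left)

lemma coeff_scaleR: "coeff t (k *\<^sub>R u) \<psi> = k *\<^sub>R coeff t u \<psi>"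
  by (simp add: coeff_def scaleR_sum_right)

lemma coeff_0 [simp]: "coeff t 0 \<psi> = 0"
  by (simp add: coeff_def)

lemma singer_minus [simp]: "singer t (singer (- t) \<psi>) = \<psi>" "singer (- t) (singer t \<psi>) = \<psi>"
  by (simp_all flip: singer_add)

lemma coeff_a: "coeff (t + 1) u (singer 1 \<psi>) = coeff t u \<psi>"
  by (simp add: coeff_def flip: singer_add)

lemma coeff_d: "coeff t (\<delta> t *s u) \<psi> * omega_pow (fst \<psi>) = omega_pow (fst (\<psi> + weight t)) * coeff t u \<psi>"
  by (simp add: coeff_scale delta_eq omega_pow_add weight_def)

lemma vector_3_0: "(vector [x, y, z] :: 'a::zero ^ 3) $ 0 = z"
proof -
  have "(0 :: 3) = 3" by simp
  then show ?thesis by (metis vector_3(3))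
qed

text \<open>
  The table that defines \<open>e\<close> follows one rule: on block \<open>t\<close>, with \<open>weight (- t) = (a, b, c)\<close>,
  coordinates are shifted by \<open>c - a\<close> and the phase is affine in the coordinate with slope \<open>a\<close>. This
  reduces \<open>coeff_e\<close> to an identity between exponents.
\<close>
lemma e_block_nth:
  assumes "weight (- t) = (a, b, c)"
  shows "e_block t u $ j = omega_pow (a * (j + (c - a) - 1)) * u $ (j - (c - a))"
proof -
  have three: "(3 :: 3) = 0" "(4 :: 3) = 1" "(5 :: 3) = 2" by simp_all
  have "\<forall>t. case weight (- t) of (a, b, c) \<Rightarrow> 
      \<forall>j. e_block t u $ j = omega_pow (a * (j + (c - a) - 1)) * u $ (j - (c - a))"
    unfolding forall_13
    by (simp add: neg_mod_13 weight_table forall_mod_3 e_block_def arith_mod_3 vector_3_0 Let_def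
        omega_pow_def three)
  then show ?thesis using assms by (auto simp: split_beta dest: spec[of _ t])
qed

lemma e_block_0: "e_block t 0 = 0"
  by (simp add: e_block_def vec_eq_iff forall_3 Let_def)

lemma coeff_e: "coeff t (e_block t u) (\<psi> + weight 0) * omega_pow (phase_e \<psi>)
    = omega_pow (phase_e (\<psi> + weight t)) * coeff t u \<psi>"
proof -
  obtain a b c where weight: "weight (- t) = (a, b, c)" by (cases "weight (- t)")
  define k where "k = c - a"
  define \<phi> where "\<phi> = singer (- t) \<psi>"
  have \<psi>: "\<psi> = singer t \<phi>" by (simp add: \<phi>_def)
  have "singer (- t) (\<psi> + weight 0) = \<phi> + (a, b, c)"
    by (simp add: singer_plus \<phi>_def singer_weight weight)
  then have "coeff t (e_block t u) (\<psi> + weight 0)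
      = (\<Sum>j\<in>UNIV. omega_pow (a * (j + k - 1)) * u $ (j - k) * base_coeff j (\<phi> + (a, b, c)))"
    by (simp add: coeff_def e_block_nth[OF weight] k_def)
  also have "\<dots> = (\<Sum>i\<in>UNIV. omega_pow (a * (i + 2 * k - 1)) * u $ i * base_coeff (i + k)
      (\<phi> + (a, b, c)))"
    by (rule sum.reindex_bij_witness[of _ "\<lambda>i. i + k" "\<lambda>j. j - k"]) (auto simp: algebra_simps)
  finally have 1: "coeff t (e_block t u) (\<psi> + weight 0) * omega_pow (phase_e \<psi>)
      = (\<Sum>i\<in>UNIV. u $ i * (omega_pow (a * (i + 2 * k - 1)) * base_coeff (i + k) (\<phi> + (a, b, c)) *
          omega_pow (phase_e \<psi>)))"
    by (simp add: sum_distrib_left mult_ac)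
  have 2: "omega_pow (a * (i + 2 * k - 1)) * base_coeff (i + k) (\<phi> + (a, b, c)) * omega_pow (phase_e \<psi>)
      = omega_pow (phase_e (\<psi> + weight t)) * base_coeff i \<phi>" for i
  proof -
    have sign3: "fst (\<phi> + (a, b, c)) - snd (snd (\<phi> + (a, b, c))) + (i + k) - 1
        = fst \<phi> - snd (snd \<phi>) + i - 1"
      by (simp add: k_def)
    have omega_pow: "omega_pow (a * (i + 2 * k - 1)) * omega_pow
        (base_phase (i + k) (\<phi> + (a, b, c))) * omega_pow (phase_e \<psi>)
        = omega_pow (phase_e (\<psi> + weight t)) * omega_pow (base_phase i \<phi>)"
      unfolding \<psi> k_def by (simp only: omega_pow_add[symmetric] phase_e_identity[OF weight])
    let ?s = "(\<omega> - \<omega>') * sign3 (fst \<phi> - snd (snd \<phi>) + i - 1)"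
    have "omega_pow (a * (i + 2 * k - 1)) * base_coeff (i + k) (\<phi> + (a, b, c)) * omega_pow (phase_e \<psi>)
      = ?s * (omega_pow (a * (i + 2 * k - 1)) * omega_pow (base_phase (i + k) (\<phi> + (a, b, c))) *
          omega_pow (phase_e \<psi>))"
      unfolding base_coeff_def sign3 by (simp only: mult_ac)
    also have "\<dots> = omega_pow (phase_e (\<psi> + weight t)) * base_coeff i \<phi>"
      unfolding omega_pow base_coeff_def by (simp only: mult_ac)
    finally show ?thesis .
  qed
  show ?thesis
    unfolding 1 2 by (simp add: coeff_def \<phi>_def sum_distrib_left mult_ac)
qed

lemma coeff_b: "coeff (3 * t) (vector [\<omega> * u $ 1, \<omega>' * u $ 2, \<omega>' * u $ 3]) (perm_b \<psi>) * omega_pow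
    (phase_b \<psi>)
    = omega_pow (phase_b (\<psi> + weight t)) * coeff t u \<psi>"
proof -
  define \<phi> where "\<phi> = singer (- t) \<psi>"
  have \<psi>: "\<psi> = singer t \<phi>" by (simp add: \<phi>_def)
  have nth: "vector [\<omega> * u $ 1, \<omega>' * u $ 2, \<omega>' * u $ 3] $ i = omega_pow (b_exp i) * u $ i" for i
  proof -
    have "\<forall>i. vector [\<omega> * u $ 1, \<omega>' * u $ 2, \<omega>' * u $ 3] $ i = omega_pow (b_exp i) * u $ i"
      unfolding forall_3 by (simp add: b_exp_def omega_pow_def)
    then show ?thesis ..
  qed
  have "singer (- (3 * t)) (perm_b \<psi>) = perm_b \<phi>"
    by (simp add: \<psi> perm_b_singer)
  then have 1: "coeff (3 * t) (vector [\<omega> * u $ 1, \<omega>' * u $ 2, \<omega>' * u $ 3]) (perm_b \<psi>) * omega_pow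
      (phase_b \<psi>)
      = (\<Sum>i\<in>UNIV. u $ i * (omega_pow (b_exp i) * base_coeff i (perm_b \<phi>) * omega_pow (phase_b \<psi>)))"
    by (simp add: coeff_def nth sum_distrib_left mult_ac)
  have 2: "omega_pow (b_exp i) * base_coeff i (perm_b \<phi>) * omega_pow (phase_b \<psi>)
      = omega_pow (phase_b (\<psi> + weight t)) * base_coeff i \<phi>" for i
  proof -
    have "\<forall>x y z. fst (perm_b (x, y, z)) - snd (snd (perm_b (x, y, z))) = x - z"
      by (simp add: perm_b_def forall_mod_3 arith_mod_3)
    then have sign3: "fst (perm_b \<phi>) - snd (snd (perm_b \<phi>)) + i - 1 = fst \<phi> - snd (snd \<phi>) + i - 1"
      by (cases \<phi>) simp
    have omega_pow: "omega_pow (b_exp i) * omega_pow (base_phase i (perm_b \<phi>)) * omega_pow (phase_b \<psi>)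
        = omega_pow (phase_b (\<psi> + weight t)) * omega_pow (base_phase i \<phi>)" if
            "fst \<phi> - snd (snd \<phi>) + i - 1 \<noteq> 0"
      unfolding \<psi> by (simp only: omega_pow_add[symmetric] phase_b_identity[OF that])
    let ?s = "(\<omega> - \<omega>') * sign3 (fst \<phi> - snd (snd \<phi>) + i - 1)"
    have "omega_pow (b_exp i) * base_coeff i (perm_b \<phi>) * omega_pow (phase_b \<psi>)
      = ?s * (omega_pow (b_exp i) * omega_pow (base_phase i (perm_b \<phi>)) * omega_pow (phase_b \<psi>))"
      unfolding base_coeff_def sign3 by (simp only: mult_ac)
    also have "\<dots> = ?s * (omega_pow (phase_b (\<psi> + weight t)) * omega_pow (base_phase i \<phi>))"
      using omega_pow by (cases "fst \<phi> - snd (snd \<phi>) + i - 1 = 0") (simp_all add: sign3_def)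
    also have "\<dots> = omega_pow (phase_b (\<psi> + weight t)) * base_coeff i \<phi>"
      unfolding base_coeff_def by (simp only: mult_ac)
    finally show ?thesis .
  qed
  show ?thesis
    unfolding 1 2 by (simp add: coeff_def \<phi>_def sum_distrib_left mult_ac)
qed

section \<open>A faithful representation by skew-Hermitian operators\<close>

text \<open>
  A weighted shift by \<open>p\<close> minus its adjoint. All operators of the representation are sums of
  these, hence skew-Hermitian.
\<close>
definition skew :: "F \<Rightarrow> (F \<Rightarrow> complex) \<Rightarrow> (F \<Rightarrow> complex) \<Rightarrow> F \<Rightarrow> complex" where
  "skew p k f \<psi> = k (\<psi> - p) * f (\<psi> - p) - cnj (k \<psi>) * f (\<psi> + p)"

definition rep :: "V \<Rightarrow> (F \<Rightarrow> complex) \<Rightarrow> F \<Rightarrow> complex" where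
  "rep v f \<psi> = (\<Sum>t\<in>UNIV. skew (weight t) (coeff t (v $ t)) f \<psi>)"

lemma rep_add: "rep (u + v) f \<psi> = rep u f \<psi> + rep v f \<psi>"
  by (simp add: rep_def skew_def coeff_add algebra_simps sum.distrib sum_subtractf)

lemma rep_scaleR: "rep (k *\<^sub>R v) f \<psi> = k *\<^sub>R rep v f \<psi>"
  by (simp add: rep_def skew_def coeff_scaleR scaleR_sum_right scaleR_diff_right)

lemma rep_minus: "rep (- v) f \<psi> = - rep v f \<psi>"
  using rep_scaleR[of "- 1" v f \<psi>] by simp

lemma rep_diff: "rep (u - v) f \<psi> = rep u f \<psi> - rep v f \<psi>"
  using rep_add[of u "- v" f \<psi>] by (simp add: rep_minus)

lemma rep_add_fun: "rep (x + y) f = (\<lambda>\<psi>. rep x f \<psi> + rep y f \<psi>)" "rep (r *\<^sub>R x) f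
    = (\<lambda>\<psi>. r *\<^sub>R rep x f \<psi>)"
  by (rule ext, simp add: rep_add rep_scaleR)+

lemma rep_fun_add: "rep v (\<lambda>\<psi>. f \<psi> + g \<psi>) \<psi> = rep v f \<psi> + rep v g \<psi>"
  by (simp add: rep_def skew_def algebra_simps sum.distrib sum_subtractf)

lemma rep_fun_diff: "rep v (\<lambda>\<psi>. f \<psi> - g \<psi>) \<psi> = rep v f \<psi> - rep v g \<psi>"
  by (simp add: rep_def skew_def algebra_simps sum.distrib sum_subtractf)

lemma rep_fun_scaleR: "rep v (\<lambda>\<psi>. k *\<^sub>R f \<psi>) \<psi> = k *\<^sub>R rep v f \<psi>"
  by (simp add: rep_def skew_def scaleR_sum_right scaleR_diff_right)

lemma rep_axis: "rep (axis s u) f = skew (weight s) (coeff s u) f"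
proof
  fix \<psi>
  have "rep (axis s u) f \<psi> = (\<Sum>t\<in>UNIV. if t = s then skew (weight s) (coeff s u) f \<psi> else 0)"
    unfolding rep_def by (intro sum.cong refl) (auto simp: axis_def skew_def)
  then show "rep (axis s u) f \<psi> = skew (weight s) (coeff s u) f \<psi>" by simp
qed

text \<open>
  If \<open>h\<close> matches the coefficients at \<open>\<pi> \<psi>\<close> with those at \<open>\<psi>\<close> up to the phases \<open>\<mu>\<close>, then the block map is
  implemented on functions by the monomial substitution \<open>f \<mapsto> g\<close>. Only the raising parts are
  compared in the hypothesis: the lowering parts are their adjoints and \<open>\<mu>\<close> is unitary.
\<close>
lemma rep_block_map:
  assumes \<sigma>: "bij \<sigma>"
    and \<pi>: "\<And>\<psi> t. \<pi> (\<psi> + weight t) = \<pi> \<psi> + weight (\<sigma> t)"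
    and \<mu>: "\<And>\<psi>. \<mu> \<psi> * cnj (\<mu> \<psi>) = 1"
    and coeff: "\<And>t u \<psi>. coeff (\<sigma> t) (h t u) (\<pi> \<psi>) * \<mu> \<psi> = \<mu> (\<psi> + weight t) * coeff t u \<psi>"
    and g: "\<And>\<psi>. g (\<pi> \<psi>) = \<mu> \<psi> * f \<psi>"
  shows "rep (block_map \<sigma> h v) g (\<pi> \<psi>) = \<mu> \<psi> * rep v f \<psi>"
proof -
  define X where "X t w = coeff t w (\<pi> \<psi> - weight t) * g (\<pi> \<psi> - weight t)
      - cnj (coeff t w (\<pi> \<psi>)) * g (\<pi> \<psi> + weight t)" for t w
  have "rep (block_map \<sigma> h v) g (\<pi> \<psi>) = (\<Sum>t\<in>UNIV. X t (block_map \<sigma> h v $ t))"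
    by (simp add: rep_def skew_def X_def)
  also have "\<dots> = (\<Sum>t\<in>UNIV. X (\<sigma> t) (block_map \<sigma> h v $ \<sigma> t))"
    using sum.reindex_bij_betw[OF \<sigma>, of "\<lambda>t. X t (block_map \<sigma> h v $ t)"] by simp
  also have "\<dots> = (\<Sum>t\<in>UNIV. X (\<sigma> t) (h t (v $ t)))"
    using \<sigma> by (simp add: block_map_nth bij_is_inj)
  also have "\<dots> = (\<Sum>t\<in>UNIV. \<mu> \<psi> * (coeff t (v $ t) (\<psi> - weight t) * f (\<psi> - weight t)
      - cnj (coeff t (v $ t) \<psi>) * f (\<psi> + weight t)))"
  proof (rule sum.cong)
    fix t
    let ?u = "v $ t"
    have down: "\<pi> \<psi> - weight (\<sigma> t) = \<pi> (\<psi> - weight t)"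
      using \<pi>[of "\<psi> - weight t" t] by (simp add: algebra_simps)
    have "coeff (\<sigma> t) (h t ?u) (\<pi> (\<psi> - weight t)) * g (\<pi> (\<psi> - weight t))
        = \<mu> \<psi> * (coeff t ?u (\<psi> - weight t) * f (\<psi> - weight t))"
      using coeff[of t ?u "\<psi> - weight t"] by (simp add: g mult.assoc[symmetric])
    moreover have "cnj (coeff (\<sigma> t) (h t ?u) (\<pi> \<psi>)) * g (\<pi> (\<psi> + weight t))
        = \<mu> \<psi> * (cnj (coeff t ?u \<psi>) * f (\<psi> + weight t))"
    proof -
      have "coeff (\<sigma> t) (h t ?u) (\<pi> \<psi>) = coeff (\<sigma> t) (h t ?u) (\<pi> \<psi>) * \<mu> \<psi> * cnj (\<mu> \<psi>)"
        by (simp add: \<mu> mult.assoc)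
      then have "cnj (coeff (\<sigma> t) (h t ?u) (\<pi> \<psi>)) = cnj (\<mu> (\<psi> + weight t)) * cnj (coeff t ?u \<psi>) * \<mu> \<psi>"
        by (simp add: coeff)
      then have "cnj (coeff (\<sigma> t) (h t ?u) (\<pi> \<psi>)) * g (\<pi> (\<psi> + weight t))
         = (\<mu> (\<psi> + weight t) * cnj (\<mu> (\<psi> + weight t))) *
             (\<mu> \<psi> * (cnj (coeff t ?u \<psi>) * f (\<psi> + weight t)))"
        by (simp add: g mult_ac)
      then show ?thesis by (simp add: \<mu>)
    qed
    ultimately show "X (\<sigma> t) (h t ?u) = \<mu> \<psi> *
        (coeff t ?u (\<psi> - weight t) * f (\<psi> - weight t) - cnj (coeff t ?u \<psi>) * f (\<psi> + weight t))"
      unfolding X_def down \<pi>[symmetric] by (simp add: algebra_simps)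
  qed simp
  also have "\<dots> = \<mu> \<psi> * rep v f \<psi>"
    by (simp add: rep_def skew_def sum_distrib_left)
  finally show ?thesis .
qed

lemma weight_add_neq_0: "weight s + weight t \<noteq> 0"
proof -
  have "\<forall>t. weight 0 + weight t \<noteq> 0"
    unfolding forall_13 by (simp only: weight_table add_Pair zero_prod_def prod.inject arith_mod_3
        simp_thms)
  then have "weight 0 + weight (t - s) \<noteq> 0" by blast
  moreover have "singer s 0 = 0" for s
    using singer_plus[of s 0 0] by simp
  moreover have "singer (- s) (weight s + weight t) = weight 0 + weight (t - s)"
    by (simp add: singer_plus singer_weight)
  ultimately show ?thesis by metis
qed

lemma weight_eq_iff: "weight s = weight t \<longleftrightarrow> s = t"
proof
  assume "weight s = weight t"
  then have "singer (- s) (weight s) = singer (- s) (weight t)" by simp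
  then have "weight 0 = weight (t - s)" by (simp add: singer_weight)
  moreover have "\<forall>t. weight 0 = weight t \<longrightarrow> t = 0"
    unfolding forall_13 by (simp only: weight_table prod.inject arith_mod_3 simp_thms)
  ultimately have "t - s = 0" by blast
  then show "s = t" by simp
qed simp

text \<open>
  Three well chosen points suffice: each coefficient function vanishes on its own plane, so at
  every point at most two of the three coordinates of \<open>u\<close> contribute.
\<close>
lemma coeff_eq_0_imp:
  assumes "\<And>\<psi>. coeff t u \<psi> = 0"
  shows "u = 0"
proof -
  have sum: "(\<Sum>i\<in>UNIV. u $ i * base_coeff i \<phi>) = 0" for \<phi>
    using assms[of "singer t \<phi>"] by (simp add: coeff_def)
  have "\<omega> - \<omega>' \<noteq> 0"
    using omega_neq_1 omega_sq by (metis \<omega>_nonzero(1) eq_iff_diff_eq_0 mult_cancel_left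
        mult.right_neutral)
  then have *: "(\<Sum>i\<in>UNIV. u $ i * (sign3 (fst \<phi> - snd (snd \<phi>) + i - 1) * omega_pow
      (base_phase i \<phi>))) = 0" for \<phi>
  proof -
    have "(\<omega> - \<omega>') * (\<Sum>i\<in>UNIV. u $ i * (sign3 (fst \<phi> - snd (snd \<phi>) + i - 1) * omega_pow
        (base_phase i \<phi>))) = 0"
      using sum[of \<phi>] by (simp add: base_coeff_def sum_distrib_left mult_ac)
    then show ?thesis using \<open>\<omega> - \<omega>' \<noteq> 0\<close> by simp
  qed
  have three: "(3 :: 3) = 0" "(4 :: 3) = 1" by simp_all
  have 23: "u $ 2 = u $ 3" "u $ 2 = \<omega>' * u $ 3"
    using *[of "(0, 0, 0)"] *[of "(1, 0, 1)"]
    by (simp_all add: sum_3 base_phase_def sign3_def omega_pow_def arith_mod_3 three)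
  moreover have "\<omega>' \<noteq> 1"
    using omega_sq omega_neq_1 by (metis mult.right_neutral)
  ultimately have "u $ 3 = 0" by simp
  moreover have "u $ 1 = 0"
    using *[of "(1, 0, 0)"] 23 \<open>u $ 3 = 0\<close>
    by (simp add: sum_3 base_phase_def sign3_def omega_pow_def arith_mod_3 three)
  ultimately show ?thesis using 23 by (simp add: vec_eq_iff forall_3)
qed

text \<open>
  The 26 vectors \<open>weight t\<close> and \<open>- weight t\<close> are distinct, so applying the operator to the indicator
  of one point isolates the contribution of each block.
\<close>
lemma rep_eq_0_imp:
  assumes "\<And>f \<psi>. rep v f \<psi> = 0"
  shows "v = 0"
proof -
  have "v $ t = 0" for t
  proof (rule coeff_eq_0_imp[of t])
    fix \<psi>
    have "0 = rep v (\<lambda>\<phi>. if \<phi> = \<psi> then 1 else 0) (\<psi> + weight t)"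
      using assms by simp
    also have "\<dots> = (\<Sum>s\<in>UNIV. if s = t then coeff t (v $ t) \<psi> else 0)"
      unfolding rep_def skew_def
    proof (intro sum.cong refl)
      fix s
      have "\<psi> + weight t + weight s \<noteq> \<psi>"
        using weight_add_neq_0[of t s] by (simp add: add.assoc)
      moreover have "\<psi> + weight t - weight s = \<psi> \<longleftrightarrow> s = t"
        by (auto simp: algebra_simps weight_eq_iff)
      ultimately show "coeff s (v $ s) (\<psi> + weight t - weight s) *
          (if \<psi> + weight t - weight s = \<psi> then 1 else 0) -
           cnj (coeff s (v $ s) (\<psi> + weight t)) * (if \<psi> + weight t + weight s = \<psi> then 1 else 0)
         = (if s = t then coeff t (v $ t) \<psi> else 0)"
        by auto
    qed
    finally show "coeff t (v $ t) \<psi> = 0" by simp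
  qed
  then show ?thesis by (simp add: vec_eq_iff)
qed

text \<open>
  Translation by \<open>weight 0\<close> multiplies all coefficient functions of block 0 by the same cube root
  of unity, namely \<open>\<omega>\<close> to the power of the third coordinate of the point. Everything in the
  commutator then becomes symmetric in \<open>u\<close> and \<open>w\<close>.
\<close>
lemma rep_commute_0: "rep (axis 0 u) (rep (axis 0 w) f) \<psi> = rep (axis 0 w) (rep (axis 0 u) f) \<psi>"
proof -
  have coeff: "coeff 0 u (\<psi> + weight 0) = omega_pow (snd (snd \<psi>)) * coeff 0 u \<psi>" for u \<psi>
  proof -
    have "base_coeff i (\<psi> + weight 0) = omega_pow (snd (snd \<psi>)) * base_coeff i \<psi>" for i
    proof -
      have "base_phase i (\<psi> + weight 0) = snd (snd \<psi>) + base_phase i \<psi>"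
        by (cases \<psi>) (simp add: base_phase_def weight_table algebra_simps)
      then show ?thesis
        by (simp add: base_coeff_def weight_table omega_pow_add mult_ac)
    qed
    then show ?thesis
      by (simp add: coeff_def sum_distrib_left mult_ac)
  qed
  have sym: "coeff 0 u (\<phi> + weight 0) * coeff 0 w \<phi> = coeff 0 w (\<phi> + weight 0) * coeff 0 u \<phi>" for \<phi>
    by (simp add: coeff)
  have inv: "coeff 0 u (\<phi> + weight 0) * cnj (coeff 0 w (\<phi> + weight 0))
      = coeff 0 u \<phi> * cnj (coeff 0 w \<phi>)" for \<phi> u w
  proof -
    have "coeff 0 u (\<phi> + weight 0) * cnj (coeff 0 w (\<phi> + weight 0))
        = (omega_pow (snd (snd \<phi>)) * cnj (omega_pow (snd (snd \<phi>)))) * (coeff 0 u \<phi> * cnj (coeff 0 w \<phi>))"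
      by (simp add: coeff mult_ac del: cnj_omega_pow_mult)
    then show ?thesis by simp
  qed
  note facts = sym[of "\<psi> - weight 0 - weight 0"] arg_cong[OF sym[of \<psi>], of cnj]
    inv[of u "\<psi> - weight 0" w] inv[of w "\<psi> - weight 0" u]
  show ?thesis
    using facts by (simp add: rep_axis skew_def) algebra
qed

text \<open>
  The four products of shifts pair up into a sum of two skew-Hermitian operators, for the shifts
  \<open>p + q\<close> and \<open>q - p\<close>. This mirrors the two blocks that occur in the bracket of two distinct blocks.
\<close>
lemma skew_commutator:
  "skew p k (skew q l f) \<psi> - skew q l (skew p k f) \<psi>
    = skew (p + q) (\<lambda>\<phi>. k (\<phi> + q) * l \<phi> - l (\<phi> + p) * k \<phi>) f \<psi>
    + skew (q - p) (\<lambda>\<phi>. l (\<phi> - p) * cnj (k (\<phi> - p)) - cnj (k (\<phi> + q - p)) * l \<phi>) f \<psi>"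
proof -
  have eqs: "\<psi> - (p + q) = \<psi> - p - q" "\<psi> - q - p = \<psi> - p - q" "\<psi> + q + p = \<psi> + p + q"
    "\<psi> + (p + q) = \<psi> + p + q" "\<psi> - (q - p) = \<psi> + p - q" "\<psi> - q + p = \<psi> + p - q"
    "\<psi> + (q - p) = \<psi> - p + q" "\<psi> + q - p = \<psi> - p + q" "\<psi> - p - q + q = \<psi> - p"
    "\<psi> - p - q + p = \<psi> - q" "\<psi> + p - q - p = \<psi> - q" "\<psi> + p - q + q - p = \<psi>"
    by simp_all
  show ?thesis
    unfolding skew_def eqs complex_cnj_diff complex_cnj_mult complex_cnj_cnj by algebra
qed

text \<open>
  Shifting by \<open>- p\<close> is the lowering part of shifting by \<open>p\<close>; needed when the sum or difference of
  two weights is minus a weight.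
\<close>
lemma skew_minus: "skew (- p) (\<lambda>\<phi>. - cnj (k (\<phi> - p))) f = skew p k f"
  by (rule ext) (simp add: skew_def)

section \<open>Commutators of the two basic pairs\<close>

abbreviation (input) e1 :: "complex^3" where "e1 \<equiv> vector [1, 0, 0]"

lemma coeff_vector: "coeff t (vector [a, b, c]) \<psi>
    = a * base_coeff 1 (singer (- t) \<psi>) + b * base_coeff 2 (singer (- t) \<psi>)
        + c * base_coeff 0 (singer (- t) \<psi>)"
proof -
  have "base_coeff 0 = base_coeff 3" by (rule arg_cong[of _ _ base_coeff]) simp
  then show ?thesis by (simp add: coeff_def sum_3)
qed

lemma coeff_minus: "coeff t (- u) \<psi> = - coeff t u \<psi>"
  using coeff_scaleR[of t "- 1" u \<psi>] by simp

lemma sign3_omega_pow_values: "sign3 0 = 0" "sign3 1 = 1" "sign3 2 = - 1" "omega_pow 0 = 1"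
    "omega_pow 1 = \<omega>" "omega_pow 2 = \<omega>'"
  by (simp_all add: sign3_def omega_pow_def)

lemma omega_reduce: "cnj \<omega> = - 1 - \<omega>" "\<omega>' = - 1 - \<omega>" "\<omega> * \<omega> = - 1 - \<omega>" "\<omega> * (\<omega> * x) = (- 1 - \<omega>) * x"
  by (simp_all add: omega_sq omega'_eq mult.assoc[symmetric] flip: \<omega>'_eq_cnj)

lemmas coeff_eval = coeff_vector coeff_minus base_coeff_def base_phase_def neg_mod_13 singer_0
    weight_table add_Pair diff_Pair prod.case fst_conv
  snd_conv arith_mod_3 sign3_omega_pow_values

text \<open>
  The coefficients that \<open>skew_commutator\<close> produces for this pair. Since \<open>weight 0 + weight 1\<close> and
  \<open>weight 1 - weight 0\<close> are \<open>weight 3\<close> and \<open>weight 9\<close>, they have to be those of the components of the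
  prescribed product in blocks 3 and 9.
\<close>
lemma coeff_commutator_0_1:
  "coeff 0 e1 (\<phi> + weight 1) * coeff 1 e1 \<phi> - coeff 1 e1 (\<phi> + weight 0) * coeff 0 e1 \<phi>
      = coeff 3 (vector [\<omega>', 1, 1]) \<phi>"
  "coeff 1 e1 (\<phi> - weight 0) * cnj (coeff 0 e1 (\<phi> - weight 0))
      - cnj (coeff 0 e1 (\<phi> + weight 1 - weight 0)) * coeff 1 e1 \<phi> = coeff 9 (- vector [1, \<omega>', \<omega>']) \<phi>"
proof -
  have 1: "\<forall>x y z. coeff 0 e1 ((x, y, z) + weight 1) * coeff 1 e1 (x, y, z)
      - coeff 1 e1 ((x, y, z) + weight 0) * coeff 0 e1 (x, y, z)
      = coeff 3 (vector [\<omega>', 1, 1]) (x, y, z)"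
    by (simp only: coeff_eval forall_mod_3 singer_eq_weight[OF weight_table(13)]
        singer_eq_weight[OF weight_table(11)] singer_eq_weight[OF weight_table(5)])
        (simp add: omega_reduce algebra_simps)
  show "coeff 0 e1 (\<phi> + weight 1) * coeff 1 e1 \<phi> - coeff 1 e1 (\<phi> + weight 0) * coeff 0 e1 \<phi>
      = coeff 3 (vector [\<omega>', 1, 1]) \<phi>"
    using 1 by (cases \<phi>) blast
  have 2: "\<forall>x y z. coeff 1 e1 ((x, y, z) - weight 0) * cnj (coeff 0 e1 ((x, y, z) - weight 0))
      - cnj (coeff 0 e1 ((x, y, z) + weight 1 - weight 0)) * coeff 1 e1 (x, y, z)
      = coeff 9 (- vector [1, \<omega>', \<omega>']) (x, y, z)"
    by (simp only: coeff_eval forall_mod_3 singer_eq_weight[OF weight_table(13)]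
        singer_eq_weight[OF weight_table(11)] singer_eq_weight[OF weight_table(5)])
        (simp add: omega_reduce algebra_simps)
  show "coeff 1 e1 (\<phi> - weight 0) * cnj (coeff 0 e1 (\<phi> - weight 0))
      - cnj (coeff 0 e1 (\<phi> + weight 1 - weight 0)) * coeff 1 e1 \<phi> = coeff 9 (- vector [1, \<omega>', \<omega>']) \<phi>"
    using 2 by (cases \<phi>) blast
qed

text \<open>
  Here \<open>weight 1 + weight 9\<close> and \<open>weight 9 - weight 1\<close> are \<open>- weight 3\<close> and \<open>- weight 0\<close>, so the
  coefficients of the prescribed product appear in the form of \<open>skew_minus\<close>.
\<close>
lemma coeff_commutator_1_9:
  "coeff 1 e1 (\<phi> + weight 9) * coeff 9 e1 \<phi> - coeff 9 e1 (\<phi> + weight 1) * coeff 1 e1 \<phi>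
      = - cnj (coeff 3 (vector [\<omega>', \<omega>, \<omega>]) (\<phi> - weight 3))"
  "coeff 9 e1 (\<phi> - weight 1) * cnj (coeff 1 e1 (\<phi> - weight 1))
      - cnj (coeff 1 e1 (\<phi> + weight 9 - weight 1)) * coeff 9 e1 \<phi>
      = - cnj (coeff 0 (- vector [1, \<omega>, \<omega>]) (\<phi> - weight 0))"
proof -
  have 1: "\<forall>x y z. coeff 1 e1 ((x, y, z) + weight 9) * coeff 9 e1 (x, y, z)
      - coeff 9 e1 ((x, y, z) + weight 1) * coeff 1 e1 (x, y, z)
      = - cnj (coeff 3 (vector [\<omega>', \<omega>, \<omega>]) ((x, y, z) - weight 3))"
    by (simp only: coeff_eval forall_mod_3 singer_eq_weight[OF weight_table(13)]
        singer_eq_weight[OF weight_table(11)] singer_eq_weight[OF weight_table(5)])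
        (simp add: omega_reduce algebra_simps)
  show "coeff 1 e1 (\<phi> + weight 9) * coeff 9 e1 \<phi> - coeff 9 e1 (\<phi> + weight 1) * coeff 1 e1 \<phi>
      = - cnj (coeff 3 (vector [\<omega>', \<omega>, \<omega>]) (\<phi> - weight 3))"
    using 1 by (cases \<phi>) blast
  have 2: "\<forall>x y z. coeff 9 e1 ((x, y, z) - weight 1) * cnj (coeff 1 e1 ((x, y, z) - weight 1))
      - cnj (coeff 1 e1 ((x, y, z) + weight 9 - weight 1)) * coeff 9 e1 (x, y, z)
      = - cnj (coeff 0 (- vector [1, \<omega>, \<omega>]) ((x, y, z) - weight 0))"
    by (simp only: coeff_eval forall_mod_3 singer_eq_weight[OF weight_table(13)]
        singer_eq_weight[OF weight_table(11)] singer_eq_weight[OF weight_table(5)])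
        (simp add: omega_reduce algebra_simps)
  show "coeff 9 e1 (\<phi> - weight 1) * cnj (coeff 1 e1 (\<phi> - weight 1))
      - cnj (coeff 1 e1 (\<phi> + weight 9 - weight 1)) * coeff 9 e1 \<phi>
      = - cnj (coeff 0 (- vector [1, \<omega>, \<omega>]) (\<phi> - weight 0))"
    using 2 by (cases \<phi>) blast
qed

section \<open>Spanning by coordinate vectors\<close>

lemma axis_add: "axis t (u + v) = axis t u + axis t v"
  for u v :: "'a::monoid_add"
  by (simp add: vec_eq_iff axis_def)

lemma axis_scaleR: "axis t (r *\<^sub>R u) = r *\<^sub>R axis t u"
  for u :: "'a::real_vector"
  by (simp add: vec_eq_iff axis_def)

lemma axis_0: "axis t 0 = 0"
  by (simp add: vec_eq_iff axis_def)

lemma sum_axis: "(\<Sum>t\<in>UNIV. axis t (x $ t)) = x"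
  for x :: "'a::comm_monoid_add ^ 'n"
proof -
  have "(\<Sum>t\<in>UNIV. axis t (x $ t) $ s) = (\<Sum>t\<in>UNIV. if t = s then x $ s else 0)" for s
    by (intro sum.cong refl) (auto simp: axis_def)
  then show ?thesis by (simp add: vec_eq_iff)
qed

lemma complex_eq_omega: obtains a b where "z = of_real a + of_real b * \<omega>"
proof -
  have Im: "Im \<omega> \<noteq> 0"
  proof
    assume "Im \<omega> = 0"
    moreover have "\<omega>' \<noteq> \<omega>"
      using omega_sq omega_neq_1 by (metis \<omega>_nonzero(1) mult_cancel_left mult.right_neutral)
    ultimately show False by (simp add: \<omega>'_eq_cnj complex_eq_iff)
  qed
  define b where "b = Im z / Im \<omega>"
  have "z = of_real (Re z - b * Re \<omega>) + of_real b * \<omega>"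
    using Im by (simp add: complex_eq_iff b_def)
  then show ?thesis by (rule that)
qed

text \<open>
  For these four indices \<open>e\<close> permutes the coordinate axes cyclically, so a real subspace that is
  stable under \<open>\<omega>\<close> and under \<open>e_block r\<close> is everything as soon as it contains \<open>e1\<close>.
\<close>
lemma complex_vector_induct:
  assumes add: "\<And>u v. P u \<Longrightarrow> P v \<Longrightarrow> P (u + v)" and scale: "\<And>r u. P u \<Longrightarrow> P (r *\<^sub>R u)"
    and omega: "\<And>u. P u \<Longrightarrow> P (\<omega> *s u)"
    and e1: "P e1" and step: "\<And>u. P u \<Longrightarrow> P (e_block r u)" and r: "r \<in> {1, 3, 5, 8}"
  shows "P u"
proof -
  have smult: "P (z *s u)" if "P u" for z u
  proof -
    obtain a b where z: "z = of_real a + of_real b * \<omega>" by (rule complex_eq_omega)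
    have "z *s u = a *\<^sub>R u + b *\<^sub>R (\<omega> *s u)"
      by (simp add: z vec_eq_iff scaleR_conv_of_real[where 'a = complex] algebra_simps)
    then show ?thesis using that by (simp add: add scale omega)
  qed
  have unscale: "P v" if "P (z *s v)" "z \<noteq> 0" for z v
    using smult[OF that(1), of "1 / z"] that(2) by (simp add: vector_smult_assoc)
  let ?e2 = "vector [0, 1, 0] :: complex^3" and ?e3 = "vector [0, 0, 1] :: complex^3"
  have "e_block 1 e1 = ?e2" "e_block 1 ?e2 = ?e3" "e_block 3 e1 = \<omega> *s ?e2" "e_block 3 ?e2 = ?e3"
    "e_block 5 e1 = ?e3" "e_block 5 ?e3 = ?e2" "e_block 8 e1 = \<omega>' *s ?e2" "e_block 8 ?e2 = ?e3"
    by (simp_all add: e_block_def vec_eq_iff forall_3)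
  then have e23: "P ?e2 \<and> P ?e3"
    using r step[OF e1] step[of ?e2] step[of ?e3] unscale[of \<omega> ?e2] unscale[of \<omega>' ?e2] by auto
  have "u = u $ 1 *s e1 + u $ 2 *s vector [0, 1, 0] + u $ 3 *s vector [0, 0, 1]"
    by (simp add: vec_eq_iff forall_3)
  then show ?thesis using e1 e23 smult add by metis
qed

lemma bij_times_3: "bij (\<lambda>t :: 13. 3 * t)"
proof (rule bij_betw_byWitness[where f' = "\<lambda>t. 9 * t"])
  have "9 * (3 * t) = t" for t :: 13
  proof -
    have "9 * (3 * t) = 27 * t" by simp
    also have "(27 :: 13) = 1" by simp
    finally show ?thesis by simp
  qed
  then show "\<forall>t\<in>UNIV. 9 * (3 * t) = (t :: 13)" "\<forall>t\<in>UNIV. 3 * (9 * t) = (t :: 13)"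
    by (simp_all only: mult.left_commute[of 3 9] ball_UNIV simp_thms)
qed auto

section \<open>Compatibility of the bracket with commutators\<close>

text \<open>
  An invariant product with the two prescribed values: the bracket of the compact Lie algebra of
  type \<open>E\<^sub>6\<close>.
\<close>
locale e6_product =
  fixes br :: "V \<Rightarrow> V \<Rightarrow> V"
  assumes bilinear: "bilinear br"
    and antisym: "antisymmetric br"
    and invariant: "H_invariant br"
    and br_0_1: "br (axis 0 e1) (axis 1 e1) = axis 3 (vector [\<omega>', 1, 1]) - axis 9 (vector [1, \<omega>', \<omega>'])"
    and br_1_9: "br (axis 1 e1) (axis 9 e1) = - axis 0 (vector [1, \<omega>, \<omega>]) + axis 3 (vector [\<omega>', \<omega>, \<omega>])"
begin

lemma br_gen: "g \<in> {gen_a, gen_b, gen_d, gen_e} \<Longrightarrow> br (g u) (g v) = g (br u v)"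
  using invariant by (simp add: H_invariant_def H_def generate.incl)

lemmas br_add_left = bilinear_ladd[OF bilinear] and br_add_right = bilinear_radd[OF bilinear]
  and br_scale_left = bilinear_lmul[OF bilinear] and br_scale_right = bilinear_rmul[OF bilinear]

lemma br_swap: "br u v = - br v u"
  using antisym unfolding antisymmetric_def by blast

definition rep_hom :: "V \<Rightarrow> V \<Rightarrow> bool" where
  "rep_hom x y \<longleftrightarrow> (\<forall>f \<psi>. rep (br x y) f \<psi> = rep x (rep y f) \<psi> - rep y (rep x f) \<psi>)"

lemma rep_hom_swap: "rep_hom x y \<Longrightarrow> rep_hom y x"
  unfolding rep_hom_def br_swap[of y x] rep_minus by simp

lemma rep_hom_add_left: "rep_hom x z \<Longrightarrow> rep_hom y z \<Longrightarrow> rep_hom (x + y) z"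
  by (simp add: rep_hom_def br_add_left rep_add rep_fun_add rep_add_fun)

lemma rep_hom_scale_left: "rep_hom x z \<Longrightarrow> rep_hom (r *\<^sub>R x) z"
  by (simp add: rep_hom_def br_scale_left rep_scaleR rep_fun_scaleR scaleR_diff_right rep_add_fun)

lemma rep_hom_add_right: "rep_hom z x \<Longrightarrow> rep_hom z y \<Longrightarrow> rep_hom z (x + y)"
  and rep_hom_scale_right: "rep_hom z x \<Longrightarrow> rep_hom z (r *\<^sub>R x)"
  by (blast intro: rep_hom_swap rep_hom_add_left rep_hom_scale_left)+

text \<open>
  The two sides of \<open>rep_hom\<close> for the images are the conjugates, by the monomial substitution of
  \<open>rep_block_map\<close>, of the two sides for \<open>x\<close> and \<open>y\<close>. Surjectivity of \<open>\<pi>\<close> makes every function arise from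
  such a substitution.
\<close>
lemma rep_hom_block_map:
  assumes g: "block_map \<sigma> h \<in> {gen_a, gen_b, gen_d, gen_e}"
    and \<sigma>: "bij \<sigma>" and surj: "surj \<pi>"
    and \<pi>: "\<And>\<psi> t. \<pi> (\<psi> + weight t) = \<pi> \<psi> + weight (\<sigma> t)"
    and \<mu>: "\<And>\<psi>. \<mu> \<psi> * cnj (\<mu> \<psi>) = 1"
    and coeff: "\<And>t u \<psi>. coeff (\<sigma> t) (h t u) (\<pi> \<psi>) * \<mu> \<psi> = \<mu> (\<psi> + weight t) * coeff t u \<psi>"
    and xy: "rep_hom x y"
  shows "rep_hom (block_map \<sigma> h x) (block_map \<sigma> h y)"
  unfolding rep_hom_def
proof (intro allI)
  fix f \<phi>
  obtain \<psi> where \<phi>: "\<phi> = \<pi> \<psi>" using surj by (metis surjD)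
  define f' where "f' \<psi> = cnj (\<mu> \<psi>) * f (\<pi> \<psi>)" for \<psi>
  have f: "f (\<pi> \<psi>) = \<mu> \<psi> * f' \<psi>" for \<psi>
    by (simp add: f'_def mult.assoc[symmetric] \<mu>)
  note rep = rep_block_map[where \<sigma> = \<sigma> and \<pi> = \<pi> and \<mu> = \<mu> and h = h, OF \<sigma> \<pi> \<mu> coeff]
  have "rep (br (block_map \<sigma> h x) (block_map \<sigma> h y)) f (\<pi> \<psi>) = \<mu> \<psi> * rep (br x y) f' \<psi>"
    unfolding br_gen[OF g] by (rule rep) (rule f)
  moreover have "rep (block_map \<sigma> h u) (rep (block_map \<sigma> h v) f) (\<pi> \<psi>)
      = \<mu> \<psi> * rep u (rep v f') \<psi>" for u v
    by (intro rep f)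
  moreover have "rep (br x y) f' \<psi> = rep x (rep y f') \<psi> - rep y (rep x f') \<psi>"
    using xy unfolding rep_hom_def by blast
  ultimately show "rep (br (block_map \<sigma> h x) (block_map \<sigma> h y)) f \<phi> =
      rep (block_map \<sigma> h x) (rep (block_map \<sigma> h y) f) \<phi>
          - rep (block_map \<sigma> h y) (rep (block_map \<sigma> h x) f) \<phi>"
    by (simp add: \<phi> right_diff_distrib)
qed

lemma rep_hom_gen:
  assumes "rep_hom x y"
  shows "rep_hom (gen_a x) (gen_a y)" "rep_hom (gen_b x) (gen_b y)" "rep_hom (gen_d x) (gen_d y)"
      "rep_hom (gen_e x) (gen_e y)"
proof -
  show "rep_hom (gen_a x) (gen_a y)"
    unfolding gen_a_def
  proof (rule rep_hom_block_map[where \<pi> = "singer 1" and \<mu> = "\<lambda>_. 1"])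
    show "bij (\<lambda>t :: 13. t + 1)"
      by (rule bij_betw_byWitness[where f' = "\<lambda>t. t - 1"]) auto
    show "surj (singer 1)" by (metis singer_minus(1) surjI)
  qed (use assms in \<open>simp_all add: gen_a_def singer_plus singer_weight coeff_a add.commute\<close>)
  show "rep_hom (gen_b x) (gen_b y)"
    unfolding gen_b_def
  proof (rule rep_hom_block_map[where \<pi> = perm_b and \<mu> = "\<lambda>\<psi>. omega_pow (phase_b \<psi>)"])
    have "\<forall>x y z. perm_b (z, y - 2 * x + z, 2 * x - z) = (x, y, z)"
      unfolding perm_b_def by (simp only: forall_mod_3 prod.case prod.inject arith_mod_3 simp_thms)
    then show "surj perm_b" by (metis surj_def prod_cases3)
  qed (use assms in \<open>simp_all add: gen_b_def perm_b_plus perm_b_weight coeff_b bij_times_3\<close>)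
  show "rep_hom (gen_d x) (gen_d y)"
    unfolding gen_d_def
    by (rule rep_hom_block_map[where \<pi> = "\<lambda>\<psi>. \<psi>" and \<mu> = "\<lambda>\<psi>. omega_pow (fst \<psi>)"])
      (use assms in \<open>simp_all add: gen_d_def coeff_d bij_id[unfolded id_def]\<close>)
  show "rep_hom (gen_e x) (gen_e y)"
    unfolding gen_e_def
  proof (rule rep_hom_block_map[where \<pi> = "\<lambda>\<psi>. \<psi> + weight 0" and \<mu> = "\<lambda>\<psi>. omega_pow (phase_e \<psi>)"])
    show "surj (\<lambda>\<psi>. \<psi> + weight 0)" by (metis diff_add_cancel surjI)
  qed (use assms in \<open>simp_all add: gen_e_def coeff_e bij_id[unfolded id_def]\<close>)
qed

lemma rep_hom_axis_shift:
  assumes "rep_hom (axis s u) (axis t w)"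
  shows "rep_hom (axis (s + k) u) (axis (t + k) w)"
proof (induction k rule: induct_13)
  case (step k)
  then show ?case
    using rep_hom_gen(1)[of "axis (s + k) u" "axis (t + k) w"]
        by (simp add: gen_a_def block_map_axis add.assoc)
qed (use assms in simp)

lemma rep_hom_axis_shift':
  assumes "rep_hom (axis (s + k) u) (axis (t + k) w)"
  shows "rep_hom (axis s u) (axis t w)"
  using rep_hom_axis_shift[OF assms, of "- k"] by simp

text \<open>
  The generator \<open>d\<close> may be replaced by its conjugate under the \<open>k\<close>-th power of \<open>a\<close>, which acts on
  block \<open>t\<close> as \<open>d\<close> does on block \<open>t + k\<close>. The same holds for \<open>e\<close> below.
\<close>
lemma rep_hom_axis_d:
  assumes "rep_hom (axis s u) (axis t w)"
  shows "rep_hom (axis s (\<delta> (s + k) *s u)) (axis t (\<delta> (t + k) *s w))"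
proof (rule rep_hom_axis_shift'[where k = k])
  show "rep_hom (axis (s + k) (\<delta> (s + k) *s u)) (axis (t + k) (\<delta> (t + k) *s w))"
    using rep_hom_gen(3)[OF rep_hom_axis_shift[OF assms, of k]] by (simp add: gen_d_def block_map_axis)
qed

lemma rep_hom_axis_e:
  assumes "rep_hom (axis s u) (axis t w)"
  shows "rep_hom (axis s (e_block (s + k) u)) (axis t (e_block (t + k) w))"
proof (rule rep_hom_axis_shift'[where k = k])
  show "rep_hom (axis (s + k) (e_block (s + k) u)) (axis (t + k) (e_block (t + k) w))"
    using rep_hom_gen(4)[OF rep_hom_axis_shift[OF assms, of k]]
        by (simp add: gen_e_def block_map_axis e_block_0)
qed

text \<open>
  One pair of vectors suffices for a pair of blocks. The conjugates of \<open>d\<close> given by \<open>k\<close> and \<open>l\<close>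
  multiply one of the two arguments by \<open>\<omega>\<close> and fix the other. The conjugate of \<open>e\<close> given by \<open>m\<close> fixes
  the first argument and moves the second one along the axes; after that, all second arguments
  are available, and the conjugate given by \<open>n\<close> moves the first.
\<close>
lemma rep_hom_axes:
  assumes base: "rep_hom (axis s e1) (axis t e1)"
    and kl: "\<delta> (s + k) = \<omega>" "\<delta> (t + k) = 1" and l: "\<delta> (s + l) = 1" "\<delta> (t + l) = \<omega>"
    and m: "s + m = 0" "t + m \<in> {1, 3, 5, 8}"
    and n: "s + n \<in> {1, 3, 5, 8}" "surj (e_block (t + n))"
  shows "rep_hom (axis s u) (axis t w)"
proof -
  have right: "rep_hom x (axis t (v + w))" "rep_hom x (axis t (r *\<^sub>R v))"
    if "rep_hom x (axis t v)" "rep_hom x (axis t w)" for x v w r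
    using that by (simp_all add: axis_add axis_scaleR rep_hom_add_right rep_hom_scale_right)
  have left: "rep_hom (axis s (u + v)) y" "rep_hom (axis s (r *\<^sub>R u)) y"
    if "rep_hom (axis s u) y" "rep_hom (axis s v) y" for u v y r
    using that by (simp_all add: axis_add axis_scaleR rep_hom_add_left rep_hom_scale_left)
  have omega: "rep_hom (axis s (\<omega> *s u)) (axis t w)" "rep_hom (axis s u) (axis t (\<omega> *s w))"
    if "rep_hom (axis s u) (axis t w)" for u w
    using rep_hom_axis_d[OF that, of k] rep_hom_axis_d[OF that, of l] by (simp_all add: kl l)
  have e_0: "e_block 0 e1 = e1"
    by (simp add: e_block_def vec_eq_iff forall_3)
  have e1: "rep_hom (axis s e1) (axis t w)" for w
  proof (rule complex_vector_induct[where P = "\<lambda>w. rep_hom (axis s e1) (axis t w)" and r = "t + m"])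
    fix w assume "rep_hom (axis s e1) (axis t w)"
    from rep_hom_axis_e[OF this, of m] show "rep_hom (axis s e1) (axis t (e_block (t + m) w))"
      by (simp only: m e_0)
  qed (use base right omega m(2) in auto)
  have "\<forall>w. rep_hom (axis s u) (axis t w)"
  proof (rule complex_vector_induct[where P = "\<lambda>u. \<forall>w. rep_hom (axis s u) (axis t w)" and r = "s + n"])
    fix u assume u: "\<forall>w. rep_hom (axis s u) (axis t w)"
    show "\<forall>w. rep_hom (axis s (e_block (s + n) u)) (axis t w)"
    proof
      fix w
      obtain w' where "w = e_block (t + n) w'" using n(2) by (rule surjE)
      with u show "rep_hom (axis s (e_block (s + n) u)) (axis t w)"
        by (simp add: rep_hom_axis_e)
    qed
  qed (use e1 left omega n(1) in \<open>blast+\<close>)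
  then show ?thesis ..
qed

lemma rep_hom_0_1: "rep_hom (axis 0 u) (axis 1 w)"
proof (rule rep_hom_axes[where k = 1 and l = 0 and m = 0 and n = 3])
  \<comment> \<open>the shifted blocks are \<open>(1, 2)\<close>, \<open>(0, 1)\<close> for \<open>d\<close> and \<open>(0, 1)\<close>, \<open>(3, 4)\<close> for \<open>e\<close>\<close>
  have sum: "weight 0 + weight 1 = weight 3" "weight 1 - weight 0 = weight 9"
    by (simp_all only: weight_table add_Pair diff_Pair arith_mod_3)
  show "rep_hom (axis 0 e1) (axis 1 e1)"
    unfolding rep_hom_def rep_axis skew_commutator coeff_commutator_0_1 sum br_0_1 
    by (simp add: rep_diff rep_axis coeff_minus skew_def)
  have "e_block 4 (vector [u $ 1, \<omega>' * u $ 2, \<omega> * u $ 3]) = u" for u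
    by (simp add: e_block_def vec_eq_iff forall_3 mult.assoc[symmetric] omega_sq)
  then have "surj (e_block 4)" by (rule surjI)
  then show "surj (e_block (1 + 3))" by simp
qed (simp_all add: \<delta>_def)

lemma rep_hom_1_9: "rep_hom (axis 1 u) (axis 9 w)"
proof (rule rep_hom_axes[where k = 3 and l = 7 and m = 12 and n = 4])
  \<comment> \<open>the shifted blocks are \<open>(4, 12)\<close>, \<open>(8, 3)\<close> for \<open>d\<close> and \<open>(0, 8)\<close>, \<open>(5, 0)\<close> for \<open>e\<close>\<close>
  have sum: "weight 1 + weight 9 = - weight 3" "weight 9 - weight 1 = - weight 0"
    by (simp_all only: weight_table add_Pair diff_Pair uminus_Pair arith_mod_3)
  show "rep_hom (axis 1 e1) (axis 9 e1)"
    unfolding rep_hom_def rep_axis skew_commutator coeff_commutator_1_9 sum skew_minus br_1_9 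
    by (simp add: rep_diff rep_axis coeff_minus skew_def)
  have "e_block 0 u = u" for u
    by (simp add: e_block_def vec_eq_iff forall_3)
  then have "surj (e_block 0)" by (rule surjI)
  moreover have "9 + 4 = (0 :: 13)" by simp
  ultimately show "surj (e_block (9 + 4))" by (simp only:)
qed (simp_all add: \<delta>_def)

section \<open>The blocks are abelian\<close>

lemma br_axis_shift: "br (axis (s + k) u) (axis (t + k) w) $ (r + k) = br (axis s u) (axis t w) $ r"
proof (induction k rule: induct_13)
  case (step k)
  have "br (axis (s + k + 1) u) (axis (t + k + 1) w) = gen_a (br (axis (s + k) u) (axis (t + k) w))"
    using br_gen[of gen_a "axis (s + k) u" "axis (t + k) w"] by (simp add: gen_a_def block_map_axis)
  moreover have "gen_a v $ (r + k + 1) = v $ (r + k)" for v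
    unfolding gen_a_def by (rule block_map_nth[of "\<lambda>t. t + 1"]) (simp add: inj_def)
  ultimately show ?case using step by (simp add: add.assoc)
qed simp

lemma br_axis_block:
  assumes g: "block_map (\<lambda>t. t) h \<in> {gen_a, gen_b, gen_d, gen_e}" and h: "\<And>t. h t 0 = 0"
  shows "br (axis s (h (s + k) u)) (axis t (h (t + k) w)) $ r
      = h (r + k) (br (axis s u) (axis t w) $ r)"
proof -
  have "br (axis s (h (s + k) u)) (axis t (h (t + k) w)) $ r
      = br (block_map (\<lambda>t. t) h (axis (s + k) u)) (block_map (\<lambda>t. t) h (axis (t + k) w)) $ (r + k)"
    by (simp add: br_axis_shift block_map_axis h)
  also have "\<dots> = h (r + k) (br (axis (s + k) u) (axis (t + k) w) $ (r + k))"
    unfolding br_gen[OF g] by (rule block_map_nth[of "\<lambda>t. t"]) simp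
  finally show ?thesis by (simp add: br_axis_shift)
qed

lemma br_axis_d: "br (axis s (\<delta> (s + k) *s u)) (axis t (\<delta> (t + k) *s w)) $ r
    = \<delta> (r + k) *s (br (axis s u) (axis t w) $ r)"
  by (rule br_axis_block) (simp_all add: gen_d_def)

lemma br_axis_e: "br (axis s (e_block (s + k) u)) (axis t (e_block (t + k) w)) $ r
    = e_block (r + k) (br (axis s u) (axis t w) $ r)"
  by (rule br_axis_block) (simp_all add: gen_e_def e_block_0)

text \<open>
  Some conjugate of \<open>d\<close> fixes block 0 pointwise and acts on block \<open>r\<close> without fixed vectors.
\<close>
lemma br_0_0_component:
  assumes "r \<noteq> 0"
  shows "br (axis 0 u) (axis 0 w) $ r = 0"
proof -
  have "\<omega>' \<noteq> 1" using omega_neq_1 omega_sq by (metis mult.right_neutral)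
  then have "\<forall>r. r \<noteq> 0 \<longrightarrow> \<delta> (r + 0) \<noteq> 1 \<or> \<delta> (r + 2) \<noteq> 1"
    unfolding forall_13 by (simp add: \<delta>_def omega_neq_1)
  moreover have "\<delta> (0 + k) = 1" if "k \<in> {0, 2}" for k
    using that by (auto simp: \<delta>_def)
  ultimately obtain k where k: "\<delta> (0 + k) = 1" "\<delta> (r + k) \<noteq> 1"
    using assms by blast
  have "br (axis 0 u) (axis 0 w) $ r = \<delta> (r + k) *s (br (axis 0 u) (axis 0 w) $ r)"
    using br_axis_d[of 0 k u 0 w r] unfolding k(1) by simp
  then show ?thesis
    using k(2) by (simp add: vec_eq_iff)
qed

definition br0 :: "complex^3 \<Rightarrow> complex^3 \<Rightarrow> complex^3" where
  "br0 u w = br (axis 0 u) (axis 0 w) $ 0"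

definition scale_coords :: "complex^3 \<Rightarrow> complex^3 \<Rightarrow> complex^3" where
  "scale_coords p u = (\<chi> i. p $ i * u $ i)"

text \<open>
  Diagonal symmetries of the product restricted to block 0. They form a group, which turns out
  to contain all diagonal matrices of cube roots of unity.
\<close>
definition br0_symmetry :: "complex^3 \<Rightarrow> bool" where
  "br0_symmetry p \<longleftrightarrow> (\<forall>u w. br0 (scale_coords p u) (scale_coords p w) = scale_coords p (br0 u w))"

lemma br0_symmetry_mult:
  assumes "br0_symmetry p" "br0_symmetry q" "\<forall>i. r $ i = p $ i * q $ i"
  shows "br0_symmetry r"
proof -
  have "scale_coords r u = scale_coords p (scale_coords q u)" for u
    using assms(3) by (simp add: scale_coords_def mult.assoc)
  with assms(1,2) show ?thesis
    by (simp add: br0_symmetry_def)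
qed

text \<open>
  On block 0 the conjugates of \<open>d\<close> and \<open>e\<close> supply only diagonal matrices with determinant 1. The
  generator \<open>b\<close> has determinant \<open>\<omega>'\<close> there, and this is what gives the remaining ones.
\<close>
lemma br0_symmetry_coordinate: "br0_symmetry (\<chi> j. if j = i then \<omega> else 1)"
proof -
  have d: "br0_symmetry (vector [\<omega>, \<omega>, \<omega>])"
  proof -
    have "scale_coords (vector [\<omega>, \<omega>, \<omega>]) u = \<delta> (0 + 1) *s u" for u
      by (simp add: scale_coords_def \<delta>_def vec_eq_iff forall_3)
    then show ?thesis using br_axis_d[of 0 1 _ 0 _ 0] by (simp add: br0_symmetry_def br0_def)
  qed
  have e: "br0_symmetry (vector [1, \<omega>, \<omega>'])"
  proof -
    have "scale_coords (vector [1, \<omega>, \<omega>']) u = e_block (0 + 4) u" for u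
      by (simp add: scale_coords_def e_block_def vec_eq_iff forall_3)
    then show ?thesis using br_axis_e[of 0 4 _ 0 _ 0] by (simp add: br0_symmetry_def br0_def)
  qed
  have b: "br0_symmetry (vector [\<omega>, \<omega>', \<omega>'])"
  proof -
    define h :: "complex^3 \<Rightarrow> complex^3" where "h = (\<lambda>u. vector [\<omega> * u $ 1, \<omega>' * u $ 2, \<omega>' * u $ 3])"
    have h: "scale_coords (vector [\<omega>, \<omega>', \<omega>']) = h"
      by (simp add: fun_eq_iff scale_coords_def h_def vec_eq_iff forall_3)
    have gen_b: "gen_b = block_map (\<lambda>t. 3 * t) (\<lambda>_. h)"
      by (simp add: gen_b_def h_def)
    have "gen_b (axis 0 u) = axis 0 (h u)" for u
      unfolding gen_b by (subst block_map_axis) (simp_all add: h_def vec_eq_iff forall_3)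
    moreover have "gen_b v $ 0 = h (v $ 0)" for v
      using block_map_nth[OF bij_is_inj[OF bij_times_3], of "\<lambda>_. h" v 0] by (simp add: gen_b)
    ultimately show ?thesis
      using br_gen[of gen_b] by (simp add: br0_symmetry_def br0_def h) metis
  qed
  have b': "br0_symmetry (vector [\<omega>', 1, 1])"
    by (rule br0_symmetry_mult[OF d b]) (simp add: forall_3 omega_sq)
  have 1: "br0_symmetry (vector [\<omega>, 1, 1])"
    by (rule br0_symmetry_mult[OF b' b']) (simp add: forall_3 omega_sq)
  have d': "br0_symmetry (vector [\<omega>', \<omega>', \<omega>'])"
    by (rule br0_symmetry_mult[OF d d]) (simp add: forall_3 omega_sq)
  have e': "br0_symmetry (vector [\<omega>', 1, \<omega>])"
    by (rule br0_symmetry_mult[OF e d']) (simp add: forall_3 omega_sq)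
  have 3: "br0_symmetry (vector [1, 1, \<omega>])"
    by (rule br0_symmetry_mult[OF 1 e']) (simp add: forall_3 omega_sq)
  have 2: "br0_symmetry (vector [1, \<omega>, 1])"
    by (rule br0_symmetry_mult[OF e 3]) (simp add: forall_3 omega_sq)
  have "(\<chi> j. if j = (1 :: 3) then \<omega> else 1) = vector [\<omega>, 1, 1]"
      "(\<chi> j. if j = (2 :: 3) then \<omega> else 1) = vector [1, \<omega>, 1]"
      "(\<chi> j. if j = (3 :: 3) then \<omega> else 1) = vector [1, 1, \<omega>]"
    unfolding vec_eq_iff forall_3 by simp_all
  then show ?thesis
    using 1 2 3 exhaust_3[of i] by (elim disjE) (simp_all only:)
qed

lemma br0_add: "br0 (u + v) w = br0 u w + br0 v w" "br0 w (u + v) = br0 w u + br0 w v"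
  and br0_scale: "br0 (r *\<^sub>R u) w = r *\<^sub>R br0 u w" "br0 w (r *\<^sub>R u) = r *\<^sub>R br0 w u"
  by (simp_all add: br0_def axis_add axis_scaleR br_add_left br_add_right br_scale_left br_scale_right)

lemma br0_swap: "br0 u w = - br0 w u"
  unfolding br0_def by (subst br_swap) simp

lemma br0_0 [simp]: "br0 0 w = 0" "br0 w 0 = 0"
  using br0_scale(1)[of 0 0 w] br0_scale(2)[of w 0 0] by simp_all

lemma br0_coordinate:
  "br0 (scale_coords (\<chi> j. if j = i then \<omega> else 1) u) (scale_coords (\<chi> j. if j = i then \<omega> else 1) w) $ j
    = (if j = i then \<omega> else 1) * br0 u w $ j"
  using br0_symmetry_coordinate[of i] by (simp add: br0_symmetry_def scale_coords_def)

lemma scale_coords_axis: "scale_coords (\<chi> j. if j = i then \<omega> else 1) (axis k x)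
    = axis k (if k = i then \<omega> * x else x)"
  by (simp add: scale_coords_def axis_def vec_eq_iff)

text \<open>
  Sum the equivariance over the three powers of the matrix that multiplies coordinate \<open>i\<close> by \<open>\<omega>\<close>:
  the first arguments add up to zero, whereas component \<open>j\<close> of the product is the same each time.
\<close>
lemma br0_axis_component:
  assumes "i \<noteq> k" and "j \<noteq> i"
  shows "br0 (axis i x) (axis k y) $ j = 0"
proof -
  have eq: "br0 (axis i (\<omega> * x)) (axis k y) $ j = br0 (axis i x) (axis k y) $ j" for x
    using br0_coordinate[of i "axis i x" "axis k y" j] assms by (simp add: scale_coords_axis)
  have "axis i x + axis i (\<omega> * x) + axis i (\<omega> * (\<omega> * x)) = axis i (x + \<omega> * x + \<omega> * \<omega> * x)"
    by (simp add: axis_add mult.assoc)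
  also have "x + \<omega> * x + \<omega> * \<omega> * x = 0"
    by (simp add: omega_sq omega'_eq algebra_simps)
  finally have "br0 (axis i x + axis i (\<omega> * x) + axis i (\<omega> * (\<omega> * x))) (axis k y) $ j = 0"
    by (simp add: axis_0)
  then show ?thesis by (simp add: br0_add eq)
qed

lemma br0_axis_neq:
  assumes "i \<noteq> k"
  shows "br0 (axis i x) (axis k y) = 0"
proof -
  have "br0 (axis i x) (axis k y) $ j = 0" for j
  proof (cases "j = i")
    case True
    then have "br0 (axis k y) (axis i x) $ j = 0" using assms by (intro br0_axis_component) auto
    then show ?thesis by (subst br0_swap) simp
  qed (use assms in \<open>simp add: br0_axis_component\<close>)
  then show ?thesis by (simp add: vec_eq_iff)
qed

text \<open>
  Real bilinearity and antisymmetry reduce this to the product of \<open>x\<close> with \<open>\<omega> x\<close>. Multiplying both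
  by \<open>\<omega>\<close> replaces the pair by \<open>\<omega> x\<close> and \<open>- x - \<omega> x\<close>, whose product is the same, but it also multiplies
  component \<open>i\<close> of the product by \<open>\<omega>\<close>.
\<close>
lemma br0_axis_same: "br0 (axis i x) (axis i y) = 0"
proof -
  have self: "br0 u u = 0" for u
  proof -
    have "2 *\<^sub>R br0 u u = 0"
      unfolding scaleR_2 using br0_swap[of u u] by (metis add.right_inverse)
    then show ?thesis by simp
  qed
  have step: "br0 u (- v - u) = br0 v u" for u v
  proof -
    have "br0 u (- v - u) = br0 u ((- 1) *\<^sub>R v + (- 1) *\<^sub>R u)" by simp
    also have "\<dots> = - br0 u v" by (simp only: br0_add br0_scale self) simp
    also have "\<dots> = br0 v u" by (rule br0_swap[symmetric])
    finally show ?thesis .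
  qed
  have omega: "br0 (axis i x) (axis i (\<omega> * x)) $ j = 0" for x j
  proof (cases "j = i")
    case False
    then obtain "j \<noteq> i" by blast
    then have "br0 (axis i x) (axis i (\<omega> * x)) $ j = \<omega> * br0 (axis i x) (axis i (\<omega> * x)) $ j"
      using br0_coordinate[of j "axis i x" "axis i (\<omega> * x)" j] by (auto simp: scale_coords_axis)
    then show ?thesis using omega_neq_1 by simp
  next
    case True
    have "axis i (\<omega> * (\<omega> * x)) = - axis i x - axis i (\<omega> * x)"
      by (simp add: axis_def vec_eq_iff omega_sq omega'_eq algebra_simps flip: mult.assoc)
    then have "br0 (axis i (\<omega> * x)) (axis i (\<omega> * (\<omega> * x))) = br0 (axis i x) (axis i (\<omega> * x))"
      by (simp only: step)
    then show ?thesis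
      using br0_coordinate[of i "axis i x" "axis i (\<omega> * x)" i] omega_neq_1
          by (simp add: scale_coords_axis True)
  qed
  show ?thesis
  proof (cases "x = 0")
    case False
    obtain a b where "y / x = of_real a + of_real b * \<omega>" by (rule complex_eq_omega)
    then have "y = a *\<^sub>R x + b *\<^sub>R (\<omega> * x)"
      using False by (simp add: field_simps scaleR_conv_of_real)
    moreover have "br0 (axis i x) (axis i (\<omega> * x)) = 0" by (simp add: vec_eq_iff omega)
    ultimately show ?thesis by (simp only: axis_add axis_scaleR br0_add br0_scale self) simp
  qed (simp add: axis_0)
qed

lemma br_0_0: "br (axis 0 u) (axis 0 w) = 0"
proof -
  have "br0 (axis i x) (axis k y) = 0" for i k x y
    by (cases "i = k") (simp_all add: br0_axis_same br0_axis_neq)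
  then have "br0 (axis 1 (u $ 1) + axis 2 (u $ 2) + axis 3 (u $ 3))
      (axis 1 (w $ 1) + axis 2 (w $ 2) + axis 3 (w $ 3)) = 0"
    by (simp add: br0_add)
  moreover have "axis 1 (u $ 1) + axis 2 (u $ 2) + axis 3 (u $ 3) = u" for u :: "complex^3"
    using sum_axis[of u] by (simp add: sum_3)
  ultimately have "br0 u w = 0" by simp
  then have "br (axis 0 u) (axis 0 w) $ r = 0" for r
    by (cases "r = 0") (simp_all add: br0_def br_0_0_component)
  then show ?thesis by (simp add: vec_eq_iff)
qed

section \<open>The Jacobi identity\<close>

lemma rep_hom_times_3:
  assumes "\<And>u w. rep_hom (axis s u) (axis t w)"
  shows "rep_hom (axis (3 * s) u) (axis (3 * t) w)"
proof -
  define h :: "complex^3 \<Rightarrow> complex^3" where "h = (\<lambda>u. vector [\<omega> * u $ 1, \<omega>' * u $ 2, \<omega>' * u $ 3])"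
  have "gen_b (axis r u) = axis (3 * r) (h u)" for r u
    unfolding gen_b_def h_def by (subst block_map_axis) (simp_all add: vec_eq_iff forall_3)
  then have "rep_hom (axis (3 * s) (h u)) (axis (3 * t) (h w))" for u w
    using rep_hom_gen(2)[OF assms[of u w]] by simp
  moreover have "h (vector [\<omega>' * u $ 1, \<omega> * u $ 2, \<omega> * u $ 3]) = u" for u
    by (simp add: h_def vec_eq_iff forall_3 omega_sq flip: mult.assoc)
  ultimately show ?thesis by metis
qed

text \<open>
  Up to order, translations and multiplication by 3 carry the pairs \<open>(0, 1)\<close> and \<open>(1, 9)\<close> to all
  pairs of distinct indices: the multiples of their differences 1 and 8 by 1, 3, 9, together
  with the negatives, are all twelve nonzero residues.
\<close>
lemma rep_hom_axis_neq:
  assumes "s \<noteq> t"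
  shows "rep_hom (axis s u) (axis t w)"
proof -
  define P where "P r \<longleftrightarrow> (\<forall>u w. rep_hom (axis 0 u) (axis r w))" for r
  have P3: "P (3 * r)" if "P r" for r
    using rep_hom_times_3[of 0 r] that unfolding P_def by simp
  have neg: "P (- r)" if "P r" for r
    using rep_hom_axis_shift[of 0 _ r _ "- r"] that unfolding P_def by (auto intro: rep_hom_swap)
  have 1: "P 1" using rep_hom_0_1 unfolding P_def by blast
  have 8: "P 8" using rep_hom_axis_shift[OF rep_hom_1_9, where k = "- 1"] unfolding P_def by simp
  have num: "3 * 3 = (9 :: 13)" "3 * 8 = (11 :: 13)" "3 * 11 = (7 :: 13)" by simp_all
  have 2: "P 3" "P 9" "P 11" "P 7"
    using P3[OF 1] P3[OF P3[OF 1]] P3[OF 8] P3[OF P3[OF 8]] by (simp_all only: num mult_1_right)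
  have 3: "P 12" "P 10" "P 4" "P 5" "P 2" "P 6"
    using neg[OF 1] neg[OF 8] 2[THEN neg] by (simp_all only: neg_mod_13)
  have "\<forall>r. r \<noteq> 0 \<longrightarrow> P r"
    unfolding forall_13 using 1 2 3 8 by simp
  with assms have "P (t - s)" by simp
  then show ?thesis
    using rep_hom_axis_shift[of 0 u "t - s" w s] unfolding P_def by simp
qed

lemma rep_hom_all: "rep_hom x y"
proof -
  have same: "rep_hom (axis t u) (axis t w)" for t u w
  proof -
    have "rep (br (axis 0 u) (axis 0 w)) f \<psi> = 0" for f \<psi>
      using rep_scaleR[of 0 0 f \<psi>] by (simp add: br_0_0)
    then have "rep_hom (axis 0 u) (axis 0 w)"
      unfolding rep_hom_def using rep_commute_0[of u w] by simp
    from rep_hom_axis_shift[OF this, of t] show ?thesis by simp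
  qed
  have zero: "rep_hom 0 y" for y
  proof -
    have "rep 0 f = (\<lambda>\<psi>. 0)" for f by (simp add: rep_def skew_def fun_eq_iff)
    moreover have "rep y (\<lambda>\<psi>. 0) \<psi> = 0" for \<psi> by (simp add: rep_def skew_def)
    ultimately show ?thesis by (simp add: rep_hom_def bilinear_lzero[OF bilinear])
  qed
  have left: "rep_hom x (axis t w)" for t w x
  proof -
    have "rep_hom (\<Sum>s\<in>S. axis s (x $ s)) (axis t w)" if "finite S" for S
      using that
    proof (induction S)
      case (insert s S)
      then show ?case
        using same rep_hom_axis_neq by (cases "s = t") (simp_all add: rep_hom_add_left)
    qed (simp add: zero)
    then show ?thesis using sum_axis[of x] by (metis finite)
  qed
  have "rep_hom x (\<Sum>t\<in>S. axis t (y $ t))" if "finite S" for S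
    using that by induction (simp_all add: zero[THEN rep_hom_swap] left rep_hom_add_right)
  then show ?thesis using sum_axis[of y] by (metis finite)
qed

lemma jacobi: "br (br x y) z + br (br y z) x + br (br z x) y = 0"
proof (rule rep_eq_0_imp)
  fix f \<psi>
  have rep_br: "rep (br x y) f = (\<lambda>\<psi>. rep x (rep y f) \<psi> - rep y (rep x f) \<psi>)" for x y f
    using rep_hom_all[of x y] unfolding rep_hom_def by blast
  show "rep (br (br x y) z + br (br y z) x + br (br z x) y) f \<psi> = 0"
    by (simp add: rep_add rep_br rep_fun_diff)
qed

end

theorem proposition1:
  fixes br :: "V \<Rightarrow> V \<Rightarrow> V"
  assumes "bilinear br"
    and "antisymmetric br"
    and "H_invariant br"
    and "br (axis 0 (vector [1, 0, 0])) (axis 1 (vector [1, 0, 0]))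
       = axis 3 (vector [\<omega>', 1, 1]) - axis 9 (vector [1, \<omega>', \<omega>'])"
    and "br (axis 1 (vector [1, 0, 0])) (axis 9 (vector [1, 0, 0]))
       = - axis 0 (vector [1, \<omega>, \<omega>]) + axis 3 (vector [\<omega>', \<omega>, \<omega>])"
  shows "\<forall>x y z. br (br x y) z + br (br y z) x + br (br z x) y = 0"
proof -
  interpret e6_product br
    using assms by unfold_locales
  show ?thesis
    using jacobi by blast
qed

end
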